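(* Let $E>0$, let $N\ge1$ be an integer, and let $(v,w)$ be a Grinevich--Zakharov pair with parameters $N$, $(\lambda_j)_{j=1}^{4N}$, $(\gamma_j)_{j=1}^{4N}$ and matrix $A$ (as defined in the context). For $l=1,\dots,4N$ put $$c_l=6E\left(\bar\lambda_l^2+\frac{1}{\lambda_l^2}+\frac{\lambda_l^2}{\bar\lambda_l^2}\right),$$ and for $k=1,\dots,N$ put $\xi_k=z-c_{4k}t$, $A^{(k)}=\{A_{lm}\}_{l,m=4(k-1)+1}^{4k}$ (a $4\times4$ submatrix of $A$) and $$\nu_k=-4\,\partial_z\partial_{\bar z}\ln\det A^{(k)},\qquad \omega_k=12\,\partial_z^2\ln\det A^{(k)},$$ regarded as functions $\nu_k(\xi_k)$, $\omega_k(\xi_k)$ of $\xi_k$. Then $$v\sim\sum_{k=1}^N\nu_k(\xi_k),\qquad w\sim\sum_{k=1}^N\omega_k(\xi_k)\qquad\text{as } t\to\infty,$$ in the following sense: for every $c\in\mathbb{C}$ and every fixed $\xi=z-ct\in\mathbb{C}$ (i.e. along $z=\xi+ct$), $$\lim_{t\to\infty}v=\lim_{t\to\infty}\sum_{k=1}^N\nu_k(\xi_k),\qquad \lim_{t\to\infty}w=\lim_{t\to\infty}\sum_{k=1}^N\omega_k(\xi_k),$$ where, for each $k$, $$\lim_{t\to\infty}\nu_k(\xi_k)=\begin{cases}0,& c\ne c_{4k},\\ \nu_k(\xi),& c=c_{4k},\end{cases}\qquad \lim_{t\to\infty}\omega_k(\xi_k)=\begin{cases}0,& c\ne c_{4k},\\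 \omega_k(\xi),& c=c_{4k}.\end{cases}$$
   Context: Notation: $x=(x_1,x_2)\in\mathbb{R}^2$, $z=x_1+ix_2$, $\bar z=x_1-ix_2$, $\partial_z=\frac12(\partial_{x_1}-i\partial_{x_2})$, $\partial_{\bar z}=\frac12(\partial_{x_1}+i\partial_{x_2})$; functions of $x$ are also written as functions of $z$. Vectors $c=(c_1,c_2)\in\mathbb{R}^2$ are identified with $c_1+ic_2\in\mathbb{C}$. Novikov--Veselov equation at energy $E$: $\partial_t v=4\,\mathrm{Re}\left(4\partial_z^3v+\partial_z(vw)-E\,\partial_z w\right)$, $\partial_{\bar z}w=-3\partial_z v$, $v=\bar v$, where $v=v(x,t)$ is real-valued and sufficiently regular and decaying as $|x|\to\infty$, and $w=w(x,t)$ decays as $|x|\to\infty$. Grinevich--Zakharov pair: fix $E>0$ (with $E^{1/2}>0$) and an integer $N\ge1$. Let $\lambda_1,\dots,\lambda_{4N},\gamma_1,\dots,\gamma_{4N}\in\mathbb{C}$ satisfy: $\lambda_j\ne0$ and $|\lambda_j|\ne1$ for $j=1,\dots,4N$; $\lambda_l\neq\lambda_m$ for $l\ne m$; $\lambda_{2j}=-\lambda_{2j-1}$ and $\gamma_{2j-1}-\gamma_{2j}=1/\lambda_{2j-1}$ for $j=1,\dots,2N$; $\lambda_{4j-1}=1/\overline{\lambda}_{4j-3}$ and $\gamma_{4j-1}=\bar\lambda_{4j-3}^2\,\bar\gamma_{4j-3}$ for $j=1,\dots,N$. Let $A=(A_{lm})$ be the $4N\times4N$ matrix $$A_{ll}=\frac{iE^{1/2}}{2}\left(\bar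 z-\frac{z}{\lambda_l^2}\right)-3iE^{3/2}t\left(\lambda_l^2-\frac{1}{\lambda_l^4}\right)-\gamma_l,\qquad A_{lm}=\frac{1}{\lambda_l-\lambda_m}\ (l\ne m).$$ The pair with these parameters is $$v(x,t)=-4\,\partial_z\partial_{\bar z}\ln\det A,\qquad w(x,t)=12\,\partial_z^2\ln\det A.$$ It is known that, for every such choice of parameters (in particular also for the $4\times 4$ blocks, which are the case $N=1$), $v$ is real-valued, $v,w$ are smooth rational functions on $\mathbb{R}^2\times\mathbb{R}$ that are $O(|x|^{-2})$ as $|x|\to\infty$ for each $t$, and $(v,w)$ solves the Novikov--Veselov equation at energy $E$. Convention: $A^{(k)}$ depends on $(z,t)$ only through $\xi_k=z-c_{4k}t$, so $\nu_k$ and $\omega_k$ are functions of $\xi_k$ alone; $\nu_k(\xi)$ and $\omega_k(\xi)$ denote the values of $-4\partial_z\partial_{\bar z}\ln\det A^{(k)}$ and $12\partial_z^2\ln\det A^{(k)}$ at $z=\xi$, $t=0$. *)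

theory Defs
  imports
    "HOL-Analysis.Complex_Transcendental"
    "Jordan_Normal_Form.Determinant"
    "Jordan_Normal_Form.DL_Submatrix"
begin

text \<open>
  The plane is identified with \<^typ>\<open>complex\<close> via z = x1 + i x2. The operators below are the
  classical (real-variable) Wirtinger derivatives: \<open>partial_x1\<close> and \<open>partial_x2\<close> are the
  derivatives along the real and the imaginary direction.
\<close>

definition partial_x1 :: "(complex \<Rightarrow> complex) \<Rightarrow> complex \<Rightarrow> complex" where
  "partial_x1 f z = vector_derivative (\<lambda>s::real. f (z + of_real s)) (at 0)"

definition partial_x2 :: "(complex \<Rightarrow> complex) \<Rightarrow> complex \<Rightarrow> complex" where
  "partial_x2 f z = vector_derivative (\<lambda>s::real. f (z + \<i> * of_real s)) (at 0)"

definition partial_z :: "(complex \<Rightarrow> complex) \<Rightarrow> complex \<Rightarrow> complex" where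
  "partial_z f z = (partial_x1 f z - \<i> * partial_x2 f z) / 2"

definition partial_zbar :: "(complex \<Rightarrow> complex) \<Rightarrow> complex \<Rightarrow> complex" where
  "partial_zbar f z = (partial_x1 f z + \<i> * partial_x2 f z) / 2"

definition gz_parameters ::
    "real \<Rightarrow> nat \<Rightarrow> (nat \<Rightarrow> complex) \<Rightarrow> (nat \<Rightarrow> complex) \<Rightarrow> bool" where
  "gz_parameters E N lam gam \<longleftrightarrow>
     E > 0 \<and> N \<ge> 1 \<and>
     (\<forall>j\<in>{1..4*N}. lam j \<noteq> 0 \<and> cmod (lam j) \<noteq> 1) \<and>
     (\<forall>l\<in>{1..4*N}. \<forall>m\<in>{1..4*N}. l \<noteq> m \<longrightarrow> lam l \<noteq> lam m) \<and>
     (\<forall>j\<in>{1..2*N}. lam (2*j) = - lam (2*j-1) \<and> gam (2*j-1) - gam (2*j) = 1 / lam (2*j-1)) \<and>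
     (\<forall>j\<in>{1..N}. lam (4*j-1) = 1 / cnj (lam (4*j-3)) \<and>
                 gam (4*j-1) = cnj (lam (4*j-3)) ^ 2 * cnj (gam (4*j-3)))"

definition gz_entry ::
    "real \<Rightarrow> (nat \<Rightarrow> complex) \<Rightarrow> (nat \<Rightarrow> complex) \<Rightarrow> complex \<Rightarrow> real \<Rightarrow> nat \<Rightarrow> nat \<Rightarrow> complex" where
  "gz_entry E lam gam z t l m =
     (if l = m
      then \<i> * of_real (sqrt E) / 2 * (cnj z - z / lam l ^ 2)
           - 3 * \<i> * of_real (E powr (3/2)) * of_real t * (lam l ^ 2 - 1 / lam l ^ 4)
           - gam l
      else 1 / (lam l - lam m))"

text \<open>
  The parameters are indexed from 1 as in the mathematical text, whereas rows and columns of a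
  \<^typ>\<open>complex mat\<close> are indexed from 0; hence the shifts by one.
\<close>

definition gz_matrix ::
    "real \<Rightarrow> nat \<Rightarrow> (nat \<Rightarrow> complex) \<Rightarrow> (nat \<Rightarrow> complex) \<Rightarrow> complex \<Rightarrow> real \<Rightarrow> complex mat" where
  "gz_matrix E N lam gam z t = mat (4*N) (4*N) (\<lambda>(i,j). gz_entry E lam gam z t (i+1) (j+1))"

definition gz_block ::
    "real \<Rightarrow> nat \<Rightarrow> (nat \<Rightarrow> complex) \<Rightarrow> (nat \<Rightarrow> complex) \<Rightarrow> nat \<Rightarrow> complex \<Rightarrow> real \<Rightarrow> complex mat" where
  "gz_block E N lam gam k z t =
     submatrix (gz_matrix E N lam gam z t) {4*(k-1)..<4*k} {4*(k-1)..<4*k}"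

text \<open>
  \<open>ln\<close> is the principal complex logarithm. Under \<^const>\<open>gz_parameters\<close> the determinants
  below are the product of a constant phase (not depending on z and t) and a real-valued function.
  Hence on every connected set on which the determinant does not vanish the principal logarithm of
  the determinant is a constant plus the real logarithm of its modulus (also when the values lie on
  the branch cut), and the derivatives do not depend on the choice of the branch.
\<close>

definition gz_v ::
    "real \<Rightarrow> nat \<Rightarrow> (nat \<Rightarrow> complex) \<Rightarrow> (nat \<Rightarrow> complex) \<Rightarrow> complex \<Rightarrow> real \<Rightarrow> complex" where
  "gz_v E N lam gam z t =
     - 4 * partial_z (partial_zbar (\<lambda>z. ln (Determinant.det (gz_matrix E N lam gam z t)))) z"

definition gz_w ::
    "real \<Rightarrow> nat \<Rightarrow> (nat \<Rightarrow> complex) \<Rightarrow> (nat \<Rightarrow> complex) \<Rightarrow> complex \<Rightarrow> real \<Rightarrow> complex" where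
  "gz_w E N lam gam z t =
     12 * partial_z (partial_z (\<lambda>z. ln (Determinant.det (gz_matrix E N lam gam z t)))) z"

definition gz_velocity :: "real \<Rightarrow> (nat \<Rightarrow> complex) \<Rightarrow> nat \<Rightarrow> complex" where
  "gz_velocity E lam l =
     6 * of_real E * (cnj (lam l) ^ 2 + 1 / lam l ^ 2 + lam l ^ 2 / cnj (lam l) ^ 2)"

text \<open>
  The profiles \<open>\<nu>\<^sub>k\<close> and \<open>\<omega>\<^sub>k\<close> as functions of one complex variable are the values at time 0.
  The lemmas \<open>gz_block_travelling\<close>, \<open>gz_nu_travelling\<close> and \<open>gz_omega_travelling\<close> below show that the
  corresponding functions of (z, t) are recovered by inserting z - c t, c being the velocity with
  index 4k.
\<close>

definition gz_nu ::
    "real \<Rightarrow> nat \<Rightarrow> (nat \<Rightarrow> complex) \<Rightarrow> (nat \<Rightarrow> complex) \<Rightarrow> nat \<Rightarrow> complex \<Rightarrow> complex" where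
  "gz_nu E N lam gam k \<xi> =
     - 4 * partial_z (partial_zbar (\<lambda>z. ln (Determinant.det (gz_block E N lam gam k z 0)))) \<xi>"

definition gz_omega ::
    "real \<Rightarrow> nat \<Rightarrow> (nat \<Rightarrow> complex) \<Rightarrow> (nat \<Rightarrow> complex) \<Rightarrow> nat \<Rightarrow> complex \<Rightarrow> complex" where
  "gz_omega E N lam gam k \<xi> =
     12 * partial_z (partial_z (\<lambda>z. ln (Determinant.det (gz_block E N lam gam k z 0)))) \<xi>"

lemma gz_velocity_block:
  assumes "gz_parameters E N lam gam" "k \<in> {1..N}" "l \<in> {4*k-3..4*k}"
  shows "gz_velocity E lam l = gz_velocity E lam (4*k)"
proof -
  have p: "lam (2*j) = - lam (2*j-1)" if "j \<in> {1..2*N}" for j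
    using assms(1) that by (simp add: gz_parameters_def)
  have q: "lam (4*k-1) = 1 / cnj (lam (4*k-3))"
    using assms(1,2) by (simp add: gz_parameters_def)
  have e: "2*(2*k) = 4*k" "2*(2*k)-1 = 4*k-1" "2*(2*k-1) = 4*k-2" "2*(2*k-1)-1 = 4*k-3"
    using assms(2) by auto
  have a: "lam (4*k) = - lam (4*k-1)" using p[of "2*k"] assms(2) unfolding e by simp
  have "2*k-1 \<in> {1..2*N}" using assms(2) by auto
  from p[OF this] have b: "lam (4*k-2) = - lam (4*k-3)" unfolding e by (simp add: numeral_eq_Suc)
  have "l = 4*k \<or> l = 4*k-1 \<or> l = 4*k-2 \<or> l = 4*k-3" using assms(3) by auto
  then show ?thesis
    by (elim disjE) (simp_all add: gz_velocity_def a b q[simplified] power_divide)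
qed

lemma gz_entry_travelling:
  assumes "E > 0" "lam l \<noteq> 0"
  shows "gz_entry E lam gam z t l m = gz_entry E lam gam (z - gz_velocity E lam l * of_real t) 0 l m"
proof -
  have E32: "E powr (3/2) = E * sqrt E"
    using powr_add[of E 1 "1/2"] assms(1) by (simp add: powr_half_sqrt)
  define c where "c = gz_velocity E lam l"
  have "cnj c - c / lam l ^ 2 = 6 * of_real E * (lam l ^ 2 - 1 / lam l ^ 4)"
    unfolding c_def gz_velocity_def using assms(2)
    by (simp add: field_simps)
  then have d: "cnj c = c / lam l ^ 2 + 6 * of_real E * (lam l ^ 2 - 1 / lam l ^ 4)"
    by (simp add: algebra_simps)
  show ?thesis
    unfolding gz_entry_def c_def[symmetric]
    by (simp add: E32 d diff_divide_distrib add_divide_distrib algebra_simps)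
qed

lemma gz_block_travelling:
  assumes "gz_parameters E N lam gam" "k \<in> {1..N}"
  shows "gz_block E N lam gam k z t =
         gz_block E N lam gam k (z - gz_velocity E lam (4*k) * of_real t) 0"
proof -
  let ?I = "{4*(k-1)..<4*k}"
  have dim: "dim_row (gz_matrix E N lam gam z t) = 4*N" "dim_col (gz_matrix E N lam gam z t) = 4*N" for z t
    by (simp_all add: gz_matrix_def)
  have r: "{i. i < 4*N \<and> i \<in> ?I} = ?I" using assms(2) by auto
  have E: "E > 0" and nz: "\<And>j. j \<in> {1..4*N} \<Longrightarrow> lam j \<noteq> 0"
    using assms(1) by (auto simp: gz_parameters_def)
  have pick: "pick ?I i \<in> ?I" if "i < card ?I" for i
    using pick_in_set_le[OF that] .
  have "gz_matrix E N lam gam z t $$ (i,j) =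
        gz_matrix E N lam gam (z - gz_velocity E lam (4*k) * of_real t) 0 $$ (i,j)"
    if "i \<in> ?I" "j \<in> ?I" for i j
  proof -
    have ij: "i < 4*N" "j < 4*N" using that assms(2) by auto
    have "i + 1 \<in> {4*k-3..4*k}" using that assms(2) by auto
    from gz_velocity_block[OF assms this] show ?thesis
      using gz_entry_travelling[where lam = lam and l = "i+1", OF E nz] ij by (simp add: gz_matrix_def)
  qed
  then have entries: "gz_matrix E N lam gam z t $$ (pick ?I i, pick ?I j) =
        gz_matrix E N lam gam (z - gz_velocity E lam (4*k) * of_real t) 0 $$ (pick ?I i, pick ?I j)"
    if "i < card ?I" "j < card ?I" for i j
    using pick[OF that(1)] pick[OF that(2)] by blast
  show ?thesis
    unfolding gz_block_def submatrix_def dim r by (rule cong_mat) (use entries in auto)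
qed

lemma partial_shift:
  "partial_x1 (\<lambda>z. f (z - a)) = (\<lambda>z. partial_x1 f (z - a))"
  "partial_x2 (\<lambda>z. f (z - a)) = (\<lambda>z. partial_x2 f (z - a))"
  "partial_z (\<lambda>z. f (z - a)) = (\<lambda>z. partial_z f (z - a))"
  "partial_zbar (\<lambda>z. f (z - a)) = (\<lambda>z. partial_zbar f (z - a))"
  by (simp_all add: fun_eq_iff partial_x1_def partial_x2_def partial_z_def partial_zbar_def
        add_diff_eq diff_add_eq)

lemma gz_nu_travelling:
  assumes "gz_parameters E N lam gam" "k \<in> {1..N}"
  shows "- 4 * partial_z (partial_zbar (\<lambda>z. ln (Determinant.det (gz_block E N lam gam k z t)))) z =
         gz_nu E N lam gam k (z - gz_velocity E lam (4*k) * of_real t)"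
  unfolding gz_nu_def gz_block_travelling[OF assms, of _ t]
  by (subst partial_shift(4)[where f = "\<lambda>z. ln (Determinant.det (gz_block E N lam gam k z 0))"])
     (subst partial_shift(3), rule refl)

lemma gz_omega_travelling:
  assumes "gz_parameters E N lam gam" "k \<in> {1..N}"
  shows "12 * partial_z (partial_z (\<lambda>z. ln (Determinant.det (gz_block E N lam gam k z t)))) z =
         gz_omega E N lam gam k (z - gz_velocity E lam (4*k) * of_real t)"
  unfolding gz_omega_def gz_block_travelling[OF assms, of _ t]
  by (subst partial_shift(3)[where f = "\<lambda>z. ln (Determinant.det (gz_block E N lam gam k z 0))"])
     (subst partial_shift(3), rule refl)

end

theory Submission
  imports Defs
begin

text \<open>
  Along a ray \<open>z = \<xi> + c t\<close> the diagonal entry of the matrix with index l depends on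
  \<open>\<xi> + (c - c\<^sub>l) t\<close> only. If c is not the velocity of l, that entry grows linearly in t; here
  \<open>|\<lambda>\<^sub>l| \<noteq> 1\<close> is essential, since it excludes a cancellation of the two terms \<open>cnj z\<close> and
  \<open>z / \<lambda>\<^sub>l\<^sup>2\<close>. If c is the velocity of l, the whole row does not depend on t at all. Dividing every
  growing row by its diagonal entry at \<open>\<xi>\<close> multiplies the determinant by a factor independent of the
  space variable, hence leaves the second derivatives of its logarithm alone, and makes the row
  converge to the corresponding row of the identity matrix. Velocities are the same within a block of
  four and different in different blocks (\<open>gz_velocity_inj\<close>), so the rows that keep their shape are those
  of one block k or there are none. Expanding along the identity rows, the limit of the scaled
  determinant is the determinant of block k, or 1. The second logarithmic derivatives therefore
  converge to those of block k, or to 0. The statement about the profiles of the single blocks is the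
  same result for N = 1, because a block is the matrix of a pair with four parameters.

  Three points make this an argument about derivatives of a principal logarithm.

  \<^item> The determinants are polynomials in z and \<open>cnj z\<close>. For these, convergence of the relevant
    derivatives up to the second order at a point (\<open>jet_tendsto\<close>) is stable under sums and products, so
    that it passes from the entries to the determinant by the Leibniz formula.
  \<^item> The logarithm has a branch cut, but each determinant D satisfies \<open>D = K * cnj D\<close> with a constant K
    (\<open>det_gz_matrix_real\<close>). Thus D moves on a line through 0, the ratio of two nearby values is a positive
    real number, and the derivatives of \<open>ln D\<close> are the usual logarithmic ones (\<open>second_partial_ln\<close>).
  \<^item> The limit has to be nonzero: the determinant of a single block is \<open>cnj \<lambda> ^ 4\<close> times the square of a
    positive number (\<open>det_single_block_nonzero\<close>).
\<close>

section \<open>Wirtinger calculus\<close>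

text \<open>
  The Frechet derivative is written in the coordinates h and \<open>cnj h\<close>; a and b are then the two
  Wirtinger derivatives.
\<close>

definition has_wirtinger :: "(complex \<Rightarrow> complex) \<Rightarrow> complex \<Rightarrow> complex \<Rightarrow> complex \<Rightarrow> bool" where
  "has_wirtinger f a b z \<longleftrightarrow> (f has_derivative (\<lambda>h. a * h + b * cnj h)) (at z)"

lemma partial_of_has_wirtinger:
  assumes "has_wirtinger f a b z"
  shows "partial_z f z = a" "partial_zbar f z = b"
proof -
  have d: "vector_derivative (\<lambda>s::real. f (z + e * of_real s)) (at 0) = a * e + b * cnj e" for e
  proof (rule vector_derivative_at)
    have "((\<lambda>s::real. z + e * of_real s) has_derivative (\<lambda>s. e * of_real s)) (at 0)"
      by (auto intro!: derivative_eq_intros)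
    from has_derivative_compose[OF this, of f "\<lambda>h. a * h + b * cnj h"] assms
    show "((\<lambda>s::real. f (z + e * of_real s)) has_vector_derivative (a * e + b * cnj e)) (at 0)"
      by (simp add: has_wirtinger_def has_vector_derivative_def scaleR_conv_of_real algebra_simps)
  qed
  have "partial_x1 f z = a + b" "partial_x2 f z = \<i> * (a - b)"
    using d[of 1] d[of \<i>] by (simp_all add: partial_x1_def partial_x2_def algebra_simps)
  then show "partial_z f z = a" "partial_zbar f z = b"
    by (simp_all add: partial_z_def partial_zbar_def)
qed

lemma has_wirtinger_const: "has_wirtinger (\<lambda>_. c) 0 0 z"
  by (simp add: has_wirtinger_def)

lemma has_wirtinger_id: "has_wirtinger (\<lambda>z. z) 1 0 z"
  by (simp add: has_wirtinger_def)

lemma has_wirtinger_cnj: "has_wirtinger cnj 0 1 z"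
  unfolding has_wirtinger_def by (auto intro!: derivative_eq_intros)

lemma has_wirtinger_add:
  "has_wirtinger f a b z \<Longrightarrow> has_wirtinger g a' b' z \<Longrightarrow>
   has_wirtinger (\<lambda>z. f z + g z) (a + a') (b + b') z"
  unfolding has_wirtinger_def
  by (drule (1) has_derivative_add) (simp add: algebra_simps)

lemma has_wirtinger_mult:
  "has_wirtinger f a b z \<Longrightarrow> has_wirtinger g a' b' z \<Longrightarrow>
   has_wirtinger (\<lambda>z. f z * g z) (f z * a' + a * g z) (f z * b' + b * g z) z"
  unfolding has_wirtinger_def
  by (drule (1) has_derivative_mult) (simp add: algebra_simps)

lemma has_wirtinger_divide:
  assumes "has_wirtinger f a b z" "has_wirtinger g a' b' z" "g z \<noteq> 0"
  shows "has_wirtinger (\<lambda>z. f z / g z) ((a * g z - f z * a') / g z ^ 2)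
           ((b * g z - f z * b') / g z ^ 2) z"
  using assms unfolding has_wirtinger_def
  by (intro has_derivative_eq_rhs[OF has_derivative_divide'])
     (auto simp: field_simps power2_eq_square)

lemma has_wirtinger_transform:
  assumes "has_wirtinger f a b z" "eventually (\<lambda>x. g x = f x) (nhds z)"
  shows "has_wirtinger g a b z"
proof -
  have "g z = f z" "eventually (\<lambda>x. f x = g x) (at z)"
    using eventually_nhds_x_imp_x[OF assms(2)] assms(2)
    by (auto simp: eventually_at_filter elim: eventually_mono)
  with assms(1) show ?thesis
    unfolding has_wirtinger_def by (auto intro: has_derivative_transform_eventually)
qed

lemma has_wirtinger_Ln:
  assumes "has_wirtinger f a b z" "f z \<notin> \<real>\<^sub>\<le>\<^sub>0"
  shows "has_wirtinger (\<lambda>z. Ln (f z)) (a / f z) (b / f z) z"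
proof -
  have "(Ln has_derivative (\<lambda>h. inverse (f z) * h)) (at (f z))"
    using has_field_derivative_Ln[OF assms(2)] by (simp add: has_field_derivative_def)
  from has_derivative_compose[OF assms(1)[unfolded has_wirtinger_def] this] show ?thesis
    unfolding has_wirtinger_def by (simp add: add_divide_distrib field_simps)
qed

text \<open>
  Polynomials in z and \<open>cnj z\<close>. The point of singling them out is closure: they are differentiable
  everywhere and their Wirtinger derivatives are again of this kind, so that second derivatives can be
  computed by applying the product rule as an identity of functions.
\<close>

inductive zpoly :: "(complex \<Rightarrow> complex) \<Rightarrow> bool" where
  const: "zpoly (\<lambda>_. c)"
| id: "zpoly (\<lambda>z. z)"
| cnj: "zpoly cnj"
| add: "zpoly f \<Longrightarrow> zpoly g \<Longrightarrow> zpoly (\<lambda>z. f z + g z)"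
| mult: "zpoly f \<Longrightarrow> zpoly g \<Longrightarrow> zpoly (\<lambda>z. f z * g z)"

lemma zpoly_derivatives:
  assumes "zpoly f"
  shows "\<exists>f' f''. zpoly f' \<and> zpoly f'' \<and> (\<forall>z. has_wirtinger f (f' z) (f'' z) z)"
  using assms
proof induction
  case (add f g)
  then obtain f' f'' g' g'' where "zpoly f'" "zpoly f''" "zpoly g'" "zpoly g''"
    "\<And>z. has_wirtinger f (f' z) (f'' z) z" "\<And>z. has_wirtinger g (g' z) (g'' z) z" by blast
  then show ?case
    by (intro exI[of _ "\<lambda>z. f' z + g' z"] exI[of _ "\<lambda>z. f'' z + g'' z"])
       (simp add: has_wirtinger_add zpoly.add)
next
  case (mult f g)
  then obtain f' f'' g' g'' where "zpoly f'" "zpoly f''" "zpoly g'" "zpoly g''"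
    "\<And>z. has_wirtinger f (f' z) (f'' z) z" "\<And>z. has_wirtinger g (g' z) (g'' z) z" by blast
  then show ?case using mult.hyps
    by (intro exI[of _ "\<lambda>z. f z * g' z + f' z * g z"] exI[of _ "\<lambda>z. f z * g'' z + f'' z * g z"])
       (simp add: has_wirtinger_mult zpoly.add zpoly.mult)
qed (use zpoly.const has_wirtinger_const has_wirtinger_id has_wirtinger_cnj in blast)+

lemma zpoly_has_wirtinger:
  assumes "zpoly f"
  shows "has_wirtinger f (partial_z f z) (partial_zbar f z) z"
  using zpoly_derivatives[OF assms] partial_of_has_wirtinger by metis

lemma zpoly_partial:
  assumes "zpoly f"
  shows "zpoly (partial_z f)" "zpoly (partial_zbar f)"
proof -
  from zpoly_derivatives[OF assms] obtain f' f'' where *: "zpoly f'" "zpoly f''"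
    "\<And>z. has_wirtinger f (f' z) (f'' z) z" by blast
  have "partial_z f = f'" "partial_zbar f = f''"
    using partial_of_has_wirtinger[OF *(3)] by (auto simp: fun_eq_iff)
  with * show "zpoly (partial_z f)" "zpoly (partial_zbar f)" by simp_all
qed

lemma partial_const:
  "partial_z (\<lambda>_. c) = (\<lambda>_. 0)" "partial_zbar (\<lambda>_. c) = (\<lambda>_. 0)"
  using partial_of_has_wirtinger[OF has_wirtinger_const] by (auto simp: fun_eq_iff)

lemma partial_add:
  assumes "zpoly f" "zpoly g"
  shows "partial_z (\<lambda>z. f z + g z) = (\<lambda>z. partial_z f z + partial_z g z)"
    "partial_zbar (\<lambda>z. f z + g z) = (\<lambda>z. partial_zbar f z + partial_zbar g z)"
  using partial_of_has_wirtinger[OF has_wirtinger_add[OF assms[THEN zpoly_has_wirtinger]]]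
  by (auto simp: fun_eq_iff)

lemma partial_mult:
  assumes "zpoly f" "zpoly g"
  shows "partial_z (\<lambda>z. f z * g z) = (\<lambda>z. f z * partial_z g z + partial_z f z * g z)"
    "partial_zbar (\<lambda>z. f z * g z) = (\<lambda>z. f z * partial_zbar g z + partial_zbar f z * g z)"
  using partial_of_has_wirtinger[OF has_wirtinger_mult[OF assms[THEN zpoly_has_wirtinger]]]
  by (auto simp: fun_eq_iff)

section \<open>Logarithmic derivatives\<close>

text \<open>
  All values of F lie on one real line through 0. Near a point where F does not vanish,
  \<open>F z / F \<xi>\<close> is a real number close to 1, and multiplication by a positive real number is
  additive for the principal logarithm even when \<open>F \<xi>\<close> is on the branch cut.
\<close>

lemma partial_ln:
  assumes F: "zpoly F" and K: "\<And>z. F z = K * cnj (F z)" and nz: "F \<xi> \<noteq> 0"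
  shows "partial_zbar (\<lambda>z. ln (F z)) \<xi> = partial_zbar F \<xi> / F \<xi>"
    "partial_z (\<lambda>z. ln (F z)) \<xi> = partial_z F \<xi> / F \<xi>"
proof -
  note dF = zpoly_has_wirtinger[OF F, of \<xi>]
  define q where "q = (\<lambda>z. F z / F \<xi>)"
  have dq: "has_wirtinger q (partial_z F \<xi> / F \<xi>) (partial_zbar F \<xi> / F \<xi>) \<xi>"
    using has_wirtinger_divide[OF dF has_wirtinger_const[of "F \<xi>"] nz] nz
    by (simp add: q_def power2_eq_square)
  have "isCont q \<xi>" using dq unfolding has_wirtinger_def
    by (rule has_derivative_continuous)
  moreover have "q \<xi> = 1" using nz by (simp add: q_def)
  ultimately have "(q \<longlongrightarrow> 1) (nhds \<xi>)"
    using tendsto_at_iff_tendsto_nhds[of q \<xi>] by (simp add: isCont_def)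
  from tendsto_Re[OF this] have "((\<lambda>z. Re (q z)) \<longlongrightarrow> 1) (nhds \<xi>)" by simp
  then have pos: "eventually (\<lambda>z. Re (q z) > 0) (nhds \<xi>)"
    by (rule order_tendstoD) simp
  have real: "q z = of_real (Re (q z))" for z
  proof -
    have "K \<noteq> 0" using K[of \<xi>] nz by auto
    then have "q z = cnj (q z)" unfolding q_def using nz
      by (subst K[of z], subst K[of \<xi>]) simp
    then show ?thesis by (metis Reals_cnj_iff of_real_Re)
  qed
  have "eventually (\<lambda>z. ln (F z) = ln (F \<xi>) + ln (q z)) (nhds \<xi>)"
    using pos
  proof eventually_elim
    case (elim z)
    have "ln (F z) = ln (of_real (Re (q z)) * F \<xi>)"
      using real[of z] nz by (simp add: q_def)
    also have "\<dots> = of_real (ln (Re (q z))) + ln (F \<xi>)"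
      using elim nz by (simp add: Ln_times_of_real Ln_of_real)
    also have "of_real (ln (Re (q z))) = ln (q z)"
      using elim real[of z] Ln_of_real by metis
    finally show ?case by simp
  qed
  moreover have "has_wirtinger (\<lambda>z. ln (F \<xi>) + ln (q z)) (partial_z F \<xi> / F \<xi>) (partial_zbar F \<xi> / F \<xi>) \<xi>"
    using has_wirtinger_add[OF has_wirtinger_const has_wirtinger_Ln[OF dq]] \<open>q \<xi> = 1\<close> by simp
  ultimately have "has_wirtinger (\<lambda>z. ln (F z)) (partial_z F \<xi> / F \<xi>) (partial_zbar F \<xi> / F \<xi>) \<xi>"
    by (rule has_wirtinger_transform[rotated])
  from partial_of_has_wirtinger[OF this]
  show "partial_zbar (\<lambda>z. ln (F z)) \<xi> = partial_zbar F \<xi> / F \<xi>"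
    "partial_z (\<lambda>z. ln (F z)) \<xi> = partial_z F \<xi> / F \<xi>" by simp_all
qed

text \<open>
  The formula for the first derivatives holds in a whole neighbourhood, so the quotient rule applies to
  it.
\<close>

lemma second_partial_ln:
  assumes F: "zpoly F" and K: "\<And>z. F z = K * cnj (F z)" and nz: "F \<xi> \<noteq> 0"
  shows "partial_z (partial_zbar (\<lambda>z. ln (F z))) \<xi> =
           (partial_z (partial_zbar F) \<xi> * F \<xi> - partial_zbar F \<xi> * partial_z F \<xi>) / F \<xi> ^ 2"
    "partial_z (partial_z (\<lambda>z. ln (F z))) \<xi> =
           (partial_z (partial_z F) \<xi> * F \<xi> - partial_z F \<xi> * partial_z F \<xi>) / F \<xi> ^ 2"
proof -
  note dF = zpoly_has_wirtinger[OF F, of \<xi>]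
  have "isCont F \<xi>" using dF unfolding has_wirtinger_def
    by (rule has_derivative_continuous)
  then have ev: "eventually (\<lambda>z. F z \<noteq> 0) (nhds \<xi>)"
    using nz tendsto_imp_eventually_ne[of F "F \<xi>" "nhds \<xi>" 0] tendsto_at_iff_tendsto_nhds[of F \<xi>]
    by (simp add: isCont_def)
  have "has_wirtinger (partial_zbar (\<lambda>z. ln (F z)))
      ((partial_z (partial_zbar F) \<xi> * F \<xi> - partial_zbar F \<xi> * partial_z F \<xi>) / F \<xi> ^ 2)
      ((partial_zbar (partial_zbar F) \<xi> * F \<xi> - partial_zbar F \<xi> * partial_zbar F \<xi>) / F \<xi> ^ 2) \<xi>"
    by (rule has_wirtinger_transform[OF has_wirtinger_divide[OF zpoly_has_wirtinger dF nz]],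
        rule zpoly_partial[OF F]) (use ev partial_ln[OF F K] in \<open>auto elim: eventually_mono\<close>)
  moreover have "has_wirtinger (partial_z (\<lambda>z. ln (F z)))
      ((partial_z (partial_z F) \<xi> * F \<xi> - partial_z F \<xi> * partial_z F \<xi>) / F \<xi> ^ 2)
      ((partial_zbar (partial_z F) \<xi> * F \<xi> - partial_z F \<xi> * partial_zbar F \<xi>) / F \<xi> ^ 2) \<xi>"
    by (rule has_wirtinger_transform[OF has_wirtinger_divide[OF zpoly_has_wirtinger dF nz]],
        rule zpoly_partial[OF F]) (use ev partial_ln[OF F K] in \<open>auto elim: eventually_mono\<close>)
  ultimately show "partial_z (partial_zbar (\<lambda>z. ln (F z))) \<xi> =
           (partial_z (partial_zbar F) \<xi> * F \<xi> - partial_zbar F \<xi> * partial_z F \<xi>) / F \<xi> ^ 2"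
    "partial_z (partial_z (\<lambda>z. ln (F z))) \<xi> =
           (partial_z (partial_z F) \<xi> * F \<xi> - partial_z F \<xi> * partial_z F \<xi>) / F \<xi> ^ 2"
    using partial_of_has_wirtinger by blast+
qed

section \<open>Convergence of 2-jets\<close>

text \<open>
  Convergence at one point of the value and of those first and second Wirtinger derivatives that enter
  the second derivatives of a logarithm.
\<close>

definition jet_tendsto ::
    "(real \<Rightarrow> complex \<Rightarrow> complex) \<Rightarrow> (complex \<Rightarrow> complex) \<Rightarrow> complex \<Rightarrow> bool" where
  "jet_tendsto f g \<xi> \<longleftrightarrow> (\<forall>t. zpoly (f t)) \<and> zpoly g \<and>
     ((\<lambda>t. f t \<xi>) \<longlongrightarrow> g \<xi>) at_top \<and>
     ((\<lambda>t. partial_z (f t) \<xi>) \<longlongrightarrow> partial_z g \<xi>) at_top \<and>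
     ((\<lambda>t. partial_zbar (f t) \<xi>) \<longlongrightarrow> partial_zbar g \<xi>) at_top \<and>
     ((\<lambda>t. partial_z (partial_z (f t)) \<xi>) \<longlongrightarrow> partial_z (partial_z g) \<xi>) at_top \<and>
     ((\<lambda>t. partial_z (partial_zbar (f t)) \<xi>) \<longlongrightarrow> partial_z (partial_zbar g) \<xi>) at_top"

lemma jet_tendsto_const: "(a \<longlongrightarrow> b) at_top \<Longrightarrow> jet_tendsto (\<lambda>t _. a t) (\<lambda>_. b) \<xi>"
  by (simp add: jet_tendsto_def zpoly.intros partial_const)

lemma jet_tendsto_refl: "zpoly f \<Longrightarrow> jet_tendsto (\<lambda>_. f) f \<xi>"
  by (simp add: jet_tendsto_def)

lemma zpoly_of_jet_tendsto: "jet_tendsto f g \<xi> \<Longrightarrow> zpoly g"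
  by (simp add: jet_tendsto_def)

lemma jet_tendsto_add:
  assumes "jet_tendsto f g \<xi>" "jet_tendsto f' g' \<xi>"
  shows "jet_tendsto (\<lambda>t z. f t z + f' t z) (\<lambda>z. g z + g' z) \<xi>"
  using assms unfolding jet_tendsto_def
  by (auto simp: partial_add zpoly_partial zpoly.add intro!: tendsto_intros)

lemma jet_tendsto_mult:
  assumes "jet_tendsto f g \<xi>" "jet_tendsto f' g' \<xi>"
  shows "jet_tendsto (\<lambda>t z. f t z * f' t z) (\<lambda>z. g z * g' z) \<xi>"
  using assms unfolding jet_tendsto_def
  by (auto simp: partial_add partial_mult zpoly_partial zpoly.add zpoly.mult intro!: tendsto_intros)

lemma jet_tendsto_sum:
  assumes "\<And>i. i \<in> I \<Longrightarrow> jet_tendsto (f i) (g i) \<xi>"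
  shows "jet_tendsto (\<lambda>t z. \<Sum>i\<in>I. f i t z) (\<lambda>z. \<Sum>i\<in>I. g i z) \<xi>"
  using assms by (induction I rule: infinite_finite_induct)
    (auto intro: jet_tendsto_refl zpoly.const jet_tendsto_add)

lemma jet_tendsto_prod:
  assumes "\<And>i. i \<in> I \<Longrightarrow> jet_tendsto (f i) (g i) \<xi>"
  shows "jet_tendsto (\<lambda>t z. \<Prod>i\<in>I. f i t z) (\<lambda>z. \<Prod>i\<in>I. g i z) \<xi>"
  using assms by (induction I rule: infinite_finite_induct)
    (auto intro: jet_tendsto_refl zpoly.const jet_tendsto_mult)

text \<open>
  The factor s does not depend on z, so it cancels in the second logarithmic derivatives. They are
  continuous functions of the 2-jet as long as the value is not 0.
\<close>

lemma log_hessian_tendsto: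
  assumes jet: "jet_tendsto (\<lambda>t z. s t * F t z) g \<xi>"
    and F: "\<And>t. zpoly (F t)" and K: "\<And>t. \<exists>K. \<forall>z. F t z = K * cnj (F t z)"
    and Kg: "\<And>z. g z = K' * cnj (g z)" and nz: "g \<xi> \<noteq> 0"
  shows "((\<lambda>t. partial_z (partial_zbar (\<lambda>z. ln (F t z))) \<xi>) \<longlongrightarrow> partial_z (partial_zbar (\<lambda>z. ln (g z))) \<xi>) at_top"
    "((\<lambda>t. partial_z (partial_z (\<lambda>z. ln (F t z))) \<xi>) \<longlongrightarrow> partial_z (partial_z (\<lambda>z. ln (g z))) \<xi>) at_top"
proof -
  define G where "G = (\<lambda>t z. s t * F t z)"
  have g: "zpoly g" using jet by (simp add: jet_tendsto_def)
  have pm: "partial_z (\<lambda>z. c * f z) = (\<lambda>z. c * partial_z f z)"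
      "partial_zbar (\<lambda>z. c * f z) = (\<lambda>z. c * partial_zbar f z)" if "zpoly f" for c f
    using that by (simp_all add: partial_mult zpoly.const partial_const)
  have lim: "((\<lambda>t. G t \<xi>) \<longlongrightarrow> g \<xi>) at_top"
     "((\<lambda>t. partial_z (G t) \<xi>) \<longlongrightarrow> partial_z g \<xi>) at_top"
     "((\<lambda>t. partial_zbar (G t) \<xi>) \<longlongrightarrow> partial_zbar g \<xi>) at_top"
     "((\<lambda>t. partial_z (partial_z (G t)) \<xi>) \<longlongrightarrow> partial_z (partial_z g) \<xi>) at_top"
     "((\<lambda>t. partial_z (partial_zbar (G t)) \<xi>) \<longlongrightarrow> partial_z (partial_zbar g) \<xi>) at_top"
    using jet by (simp_all add: jet_tendsto_def G_def)
  have "eventually (\<lambda>t. G t \<xi> \<noteq> 0) at_top"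
    using lim(1) nz by (rule tendsto_imp_eventually_ne)
  then have ev: "eventually (\<lambda>t.
      (partial_z (partial_zbar (G t)) \<xi> * G t \<xi> - partial_zbar (G t) \<xi> * partial_z (G t) \<xi>) / G t \<xi> ^ 2
        = partial_z (partial_zbar (\<lambda>z. ln (F t z))) \<xi> \<and>
      (partial_z (partial_z (G t)) \<xi> * G t \<xi> - partial_z (G t) \<xi> * partial_z (G t) \<xi>) / G t \<xi> ^ 2
        = partial_z (partial_z (\<lambda>z. ln (F t z))) \<xi>) at_top"
  proof eventually_elim
    case (elim t)
    then have st: "s t \<noteq> 0" "F t \<xi> \<noteq> 0" by (auto simp: G_def)
    obtain K where K: "\<And>z. F t z = K * cnj (F t z)" using K by blast
    show ?case
      unfolding second_partial_ln[OF F K st(2)] using st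
      by (simp add: G_def pm F zpoly_partial field_simps power2_eq_square)
  qed
  have "((\<lambda>t. (partial_z (partial_zbar (G t)) \<xi> * G t \<xi> - partial_zbar (G t) \<xi> * partial_z (G t) \<xi>) / G t \<xi> ^ 2)
      \<longlongrightarrow> partial_z (partial_zbar (\<lambda>z. ln (g z))) \<xi>) at_top"
    unfolding second_partial_ln[OF g Kg nz] using nz by (intro tendsto_intros lim) auto
  then show "((\<lambda>t. partial_z (partial_zbar (\<lambda>z. ln (F t z))) \<xi>) \<longlongrightarrow> partial_z (partial_zbar (\<lambda>z. ln (g z))) \<xi>) at_top"
    by (rule Lim_transform_eventually) (use ev in \<open>auto elim: eventually_mono\<close>)
  have "((\<lambda>t. (partial_z (partial_z (G t)) \<xi> * G t \<xi> - partial_z (G t) \<xi> * partial_z (G t) \<xi>) / G t \<xi> ^ 2)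
      \<longlongrightarrow> partial_z (partial_z (\<lambda>z. ln (g z))) \<xi>) at_top"
    unfolding second_partial_ln[OF g Kg nz] using nz by (intro tendsto_intros lim) auto
  then show "((\<lambda>t. partial_z (partial_z (\<lambda>z. ln (F t z))) \<xi>) \<longlongrightarrow> partial_z (partial_z (\<lambda>z. ln (g z))) \<xi>) at_top"
    by (rule Lim_transform_eventually) (use ev in \<open>auto elim: eventually_mono\<close>)
qed

section \<open>Determinants\<close>

lemma det_mat_leibniz:
  fixes c :: "nat \<Rightarrow> nat \<Rightarrow> complex"
  shows "det (mat n n (\<lambda>(i,j). c i j)) =
    (\<Sum>p\<in>{p. p permutes {0..<n}}. signof p * (\<Prod>i\<in>{0..<n}. c i (p i)))"
  by (subst det_def'[where n = n]) (auto intro!: sum.cong prod.cong)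

lemma jet_tendsto_det:
  assumes "\<And>i j. i < n \<Longrightarrow> j < n \<Longrightarrow> jet_tendsto (a i j) (b i j) \<xi>"
  shows "jet_tendsto (\<lambda>t z. det (mat n n (\<lambda>(i,j). a i j t z))) (\<lambda>z. det (mat n n (\<lambda>(i,j). b i j z))) \<xi>"
  unfolding det_mat_leibniz
  by (intro jet_tendsto_sum jet_tendsto_mult jet_tendsto_prod assms)
     (auto simp: jet_tendsto_refl zpoly.const)

text \<open>
  In each Leibniz term every row index and every column index occurs exactly once.
\<close>

lemma det_scale:
  fixes a :: "nat \<Rightarrow> nat \<Rightarrow> complex"
  shows "det (mat n n (\<lambda>(i,j). s i * a i j * r j)) =
    (\<Prod>i<n. s i) * (\<Prod>i<n. r i) * det (mat n n (\<lambda>(i,j). a i j))"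
proof -
  have "(\<Prod>i\<in>{0..<n}. s i * a i (p i) * r (p i)) =
      (\<Prod>i<n. s i) * (\<Prod>i<n. r i) * (\<Prod>i\<in>{0..<n}. a i (p i))" if "p permutes {0..<n}" for p
    using prod.permute[OF that, of r] by (simp add: prod.distrib atLeast0LessThan o_def)
  then show ?thesis unfolding det_mat_leibniz sum_distrib_left by (intro sum.cong) auto
qed

lemma det_cnj:
  fixes a :: "nat \<Rightarrow> nat \<Rightarrow> complex"
  shows "det (mat n n (\<lambda>(i,j). cnj (a i j))) = cnj (det (mat n n (\<lambda>(i,j). a i j)))"
  unfolding det_mat_leibniz by simp

lemma det_permute_both:
  assumes A: "A \<in> carrier_mat n n" and p: "p permutes {0..<n}"
  shows "det (mat n n (\<lambda>(i,j). A $$ (p i, p j))) = det (A :: complex mat)"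
proof -
  have pn: "p i < n" if "i < n" for i using permutes_in_image[OF p, of i] that by auto
  define B where "B = mat n n (\<lambda>(i,j). A $$ (p i, j))"
  have B: "B \<in> carrier_mat n n" "B\<^sup>T \<in> carrier_mat n n" by (simp_all add: B_def)
  have "det (mat n n (\<lambda>(i,j). A $$ (p i, p j))) = det ((mat n n (\<lambda>(i,j). A $$ (p i, p j)))\<^sup>T)"
    by (rule det_transpose[symmetric, where n = n]) simp
  also have "(mat n n (\<lambda>(i,j). A $$ (p i, p j)))\<^sup>T = mat n n (\<lambda>(i,j). B\<^sup>T $$ (p i, j))"
    by (rule eq_matI) (use A pn in \<open>auto simp: B_def\<close>)
  also have "det \<dots> = signof p * det B"
    using det_permute_rows[OF B(2) p] det_transpose[OF B(1)] by simp
  also have "det B = signof p * det A"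
    unfolding B_def by (rule det_permute_rows[OF A p])
  also have "signof p * (signof p * det A) = det A"
    by (simp add: sign_def)
  finally show ?thesis .
qed

text \<open>
  Split off the first a indices: the upper right corner vanishes. On the remaining b + d indices the
  lower left corner vanishes. Both times the determinant is the product of those of the diagonal blocks.
\<close>

lemma det_identity_outside_rows:
  fixes f :: "nat \<Rightarrow> nat \<Rightarrow> complex"
  shows "det (mat (a+(b+d)) (a+(b+d)) (\<lambda>(i,j). if i \<in> {a..<a+b} then f i j else if i = j then 1 else 0)) =
    det (mat b b (\<lambda>(i,j). f (a+i) (a+j)))" (is "det ?M = det ?B")
proof -
  let ?D = "four_block_mat ?B (mat b d (\<lambda>(i,j). f (a+i) (a+(b+j)))) (0\<^sub>m d b) (1\<^sub>m d)"
  have "det ?M = det (four_block_mat (1\<^sub>m a) (0\<^sub>m a (b+d)) (mat (b+d) a (\<lambda>(i,j). if i < b then f (a+i) j else 0)) ?D)"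
    by (rule arg_cong[where f = det], rule eq_matI) auto
  also have "\<dots> = det (1\<^sub>m a :: complex mat) * det ?D"
    by (rule det_four_block_mat_upper_right_zero) auto
  also have "det ?D = det ?B * det (1\<^sub>m d :: complex mat)"
    by (rule det_four_block_mat_lower_left_zero) auto
  finally show ?thesis by simp
qed

lemma det_mat_Suc:
  fixes f :: "nat \<Rightarrow> nat \<Rightarrow> complex"
  shows "det (mat (Suc n) (Suc n) (\<lambda>(i,j). f i j)) =
    (\<Sum>j<Suc n. f 0 j * ((-1) ^ j * det (mat n n (\<lambda>(i,k). f (Suc i) (if k < j then k else Suc k)))))"
proof -
  let ?A = "mat (Suc n) (Suc n) (\<lambda>(i,j). f i j)"
  have *: "mat_delete ?A 0 j = mat n n (\<lambda>(i,k). f (Suc i) (if k < j then k else Suc k))" for j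
    by (rule eq_matI) (auto simp: mat_delete_def)
  have "det ?A = (\<Sum>j<Suc n. ?A $$ (0,j) * cofactor ?A 0 j)"
    by (rule laplace_expansion_row) auto
  then show ?thesis unfolding cofactor_def * by (simp del: sum.lessThan_Suc)
qed

lemma det_mat_2:
  fixes f :: "nat \<Rightarrow> nat \<Rightarrow> complex"
  shows "det (mat 2 2 (\<lambda>(i,j). f i j)) = f 0 0 * f 1 1 - f 0 1 * f 1 0"
  unfolding numeral_2_eq_2 det_mat_Suc by (simp add: lessThan_Suc)

lemma det_mat_3:
  fixes f :: "nat \<Rightarrow> nat \<Rightarrow> complex"
  shows "det (mat 3 3 (\<lambda>(i,j). f i j)) =
    f 0 0 * (f 1 1 * f 2 2 - f 1 2 * f 2 1) - f 0 1 * (f 1 0 * f 2 2 - f 1 2 * f 2 0)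
    + f 0 2 * (f 1 0 * f 2 1 - f 1 1 * f 2 0)"
proof -
  have 3: "3 = Suc 2" by simp
  show ?thesis unfolding 3 det_mat_Suc det_mat_2 by (simp add: numeral_2_eq_2 lessThan_Suc algebra_simps)
qed

lemma det_mat_4:
  fixes f :: "nat \<Rightarrow> nat \<Rightarrow> complex"
  shows "det (mat 4 4 (\<lambda>(i,j). f i j)) =
      f 0 0 * (f 1 1 * (f 2 2 * f 3 3 - f 2 3 * f 3 2) - f 1 2 * (f 2 1 * f 3 3 - f 2 3 * f 3 1)
        + f 1 3 * (f 2 1 * f 3 2 - f 2 2 * f 3 1))
    - f 0 1 * (f 1 0 * (f 2 2 * f 3 3 - f 2 3 * f 3 2) - f 1 2 * (f 2 0 * f 3 3 - f 2 3 * f 3 0)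
        + f 1 3 * (f 2 0 * f 3 2 - f 2 2 * f 3 0))
    + f 0 2 * (f 1 0 * (f 2 1 * f 3 3 - f 2 3 * f 3 1) - f 1 1 * (f 2 0 * f 3 3 - f 2 3 * f 3 0)
        + f 1 3 * (f 2 0 * f 3 1 - f 2 1 * f 3 0))
    - f 0 3 * (f 1 0 * (f 2 1 * f 3 2 - f 2 2 * f 3 1) - f 1 1 * (f 2 0 * f 3 2 - f 2 2 * f 3 0)
        + f 1 2 * (f 2 0 * f 3 1 - f 2 1 * f 3 0))"
proof -
  have 4: "4 = Suc 3" by simp
  show ?thesis unfolding 4 det_mat_Suc det_mat_3 by (simp add: numeral_2_eq_2 numeral_3_eq_3 lessThan_Suc algebra_simps)
qed

section \<open>Blocks have distinct velocities\<close>

text \<open>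
  The velocity of a, divided by 6E, is the number c in the cubic
  \<open>q\<^sup>3 - cnj c * q\<^sup>2 + c * q - 1\<close>, whose roots are \<open>a\<^sup>2\<close>, \<open>1 / cnj a\<^sup>2\<close> and
  \<open>cnj a\<^sup>2 / a\<^sup>2\<close>. If b has the same velocity, then \<open>b\<^sup>2\<close> is one of these roots; the third one
  has modulus 1 and is excluded.
\<close>

lemma velocity_eq_imp_square_eq:
  fixes a b :: complex
  assumes nz: "a \<noteq> 0" "b \<noteq> 0" and mod: "cmod a \<noteq> 1" "cmod b \<noteq> 1"
    and eq: "cnj b ^ 2 + 1 / b ^ 2 + b ^ 2 / cnj b ^ 2 = cnj a ^ 2 + 1 / a ^ 2 + a ^ 2 / cnj a ^ 2"
  shows "b ^ 2 = a ^ 2 \<or> b ^ 2 = 1 / cnj a ^ 2"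
proof -
  define c where "c = cnj a ^ 2 + 1 / a ^ 2 + a ^ 2 / cnj a ^ 2"
  have root: "(q - x ^ 2) * (q - 1 / cnj x ^ 2) * (q - cnj x ^ 2 / x ^ 2) = q ^ 3 - cnj c * q ^ 2 + c * q - 1"
    if "x \<noteq> 0" "cnj x ^ 2 + 1 / x ^ 2 + x ^ 2 / cnj x ^ 2 = c" for x q
  proof -
    have "(q - X) * (q - 1 / Y) * (q - Y / X) = q ^ 3 - (X + 1 / Y + Y / X) * q ^ 2 + (Y + 1 / X + X / Y) * q - 1"
      if "X \<noteq> 0" "Y \<noteq> 0" for X Y :: complex
      using that by (simp add: field_simps power2_eq_square power3_eq_cube)
    from this[of "x ^ 2" "cnj x ^ 2"] that(1) show ?thesis
      unfolding that(2)[symmetric] by simp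
  qed
  \<comment> \<open>Both sides are the value of the cubic at \<open>b\<^sup>2\<close>, factored with the roots from a and from b.\<close>
  have "(b ^ 2 - a ^ 2) * (b ^ 2 - 1 / cnj a ^ 2) * (b ^ 2 - cnj a ^ 2 / a ^ 2) =
      (b ^ 2 - b ^ 2) * (b ^ 2 - 1 / cnj b ^ 2) * (b ^ 2 - cnj b ^ 2 / b ^ 2)"
    by (subst (1 2) root) (use nz eq in \<open>auto simp: c_def\<close>)
  then have "b ^ 2 = a ^ 2 \<or> b ^ 2 = 1 / cnj a ^ 2 \<or> b ^ 2 = cnj a ^ 2 / a ^ 2"
    by auto
  moreover have "b ^ 2 \<noteq> cnj a ^ 2 / a ^ 2"
  proof
    assume "b ^ 2 = cnj a ^ 2 / a ^ 2"
    then have "cmod (b ^ 2) = 1" using nz by (simp add: norm_divide norm_power)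
    then show False using mod(2) by (auto simp: norm_power power2_eq_1_iff dest: order_trans[OF norm_ge_zero eq_refl])
  qed
  ultimately show ?thesis by blast
qed

lemma gz_parameters_block:
  assumes "gz_parameters E N lam gam" "k \<in> {1..N}"
  shows "lam (4*k-2) = - lam (4*k-3)" "gam (4*k-2) = gam (4*k-3) - 1 / lam (4*k-3)"
    "lam (4*k-1) = 1 / cnj (lam (4*k-3))"
    "gam (4*k-1) = cnj (lam (4*k-3)) ^ 2 * cnj (gam (4*k-3))"
    "lam (4*k) = - 1 / cnj (lam (4*k-3))"
    "gam (4*k) = cnj (lam (4*k-3)) ^ 2 * cnj (gam (4*k-3)) - cnj (lam (4*k-3))"
    "lam (4*k-3) \<noteq> 0" "cmod (lam (4*k-3)) \<noteq> 1"
proof -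
  have p: "lam (2*j) = - lam (2*j-1)" "gam (2*j) = gam (2*j-1) - 1 / lam (2*j-1)" if "j \<in> {1..2*N}" for j
    using assms(1) that by (auto simp: gz_parameters_def algebra_simps)
  have e: "2*(2*k) = 4*k" "2*(2*k)-1 = 4*k-1" "2*(2*k-1) = 4*k-2" "2*(2*k-1)-1 = 4*k-3"
    using assms(2) by auto
  show q: "lam (4*k-1) = 1 / cnj (lam (4*k-3))"
    "gam (4*k-1) = cnj (lam (4*k-3)) ^ 2 * cnj (gam (4*k-3))"
    using assms(1,2) by (simp_all add: gz_parameters_def)
  show "lam (4*k) = - 1 / cnj (lam (4*k-3))"
    "gam (4*k) = cnj (lam (4*k-3)) ^ 2 * cnj (gam (4*k-3)) - cnj (lam (4*k-3))"
    using p[of "2*k"] assms(2) unfolding e q by simp_all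
  have "2*k-1 \<in> {1..2*N}" using assms(2) by auto
  from p[OF this] show "lam (4*k-2) = - lam (4*k-3)"
    "gam (4*k-2) = gam (4*k-3) - 1 / lam (4*k-3)"
    unfolding e by simp_all
  have "4*k-3 \<in> {1..4*N}" using assms(2) by auto
  then show "lam (4*k-3) \<noteq> 0" "cmod (lam (4*k-3)) \<noteq> 1"
    using assms(1) by (auto simp: gz_parameters_def)
qed

text \<open>
  Equal velocities would force a parameter of one block to be one of
  \<open>\<lambda>, -\<lambda>, 1 / cnj \<lambda>, -1 / cnj \<lambda>\<close> for a parameter \<open>\<lambda>\<close> of the other; but these four
  numbers are exactly the parameters of that block, and all parameters are distinct.
\<close>

lemma gz_velocity_inj:
  assumes "gz_parameters E N lam gam" "k \<in> {1..N}" "k' \<in> {1..N}" "k \<noteq> k'"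
  shows "gz_velocity E lam (4*k) \<noteq> gz_velocity E lam (4*k')"
proof
  assume eq: "gz_velocity E lam (4*k) = gz_velocity E lam (4*k')"
  note b = gz_parameters_block[OF assms(1,2)] gz_parameters_block[OF assms(1,3)]
  have E: "E > 0" using assms(1) by (simp add: gz_parameters_def)
  have v: "gz_velocity E lam (4*j) = gz_velocity E lam (4*j-3)" if "j \<in> {1..N}" for j
    using gz_velocity_block[OF assms(1) that, of "4*j-3"] that by simp
  have dist: "lam l \<noteq> lam m" if "l \<in> {1..4*N}" "m \<in> {1..4*N}" "l \<noteq> m" for l m
    using assms(1) that by (auto simp: gz_parameters_def)
  let ?a = "lam (4*k-3)" and ?b = "lam (4*k'-3)"
  have "?b ^ 2 = ?a ^ 2 \<or> ?b ^ 2 = (1 / cnj ?a) ^ 2"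
    using velocity_eq_imp_square_eq[OF b(7) b(15) b(8) b(16)] eq E
    unfolding v[OF assms(2)] v[OF assms(3)] by (simp add: gz_velocity_def power_divide)
  then have "?b = ?a \<or> ?b = lam (4*k-2) \<or> ?b = lam (4*k-1) \<or> ?b = lam (4*k)"
    unfolding power2_eq_iff b by auto
  moreover have "4*k'-3 \<in> {1..4*N}" "4*k-3 \<in> {1..4*N}" "4*k-2 \<in> {1..4*N}"
    "4*k-1 \<in> {1..4*N}" "4*k \<in> {1..4*N}"
    using assms(2,3) by auto
  moreover have "4*k'-3 \<noteq> 4*k-3" "4*k'-3 \<noteq> 4*k-2" "4*k'-3 \<noteq> 4*k-1" "4*k'-3 \<noteq> 4*k"
    using assms(2-4) by (cases "k < k'"; simp)+
  ultimately show False using dist by metis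
qed

lemma gz_velocity_index:
  assumes "gz_parameters E N lam gam" "i < 4*N"
  shows "gz_velocity E lam (i+1) = gz_velocity E lam (4 * (i div 4 + 1))" "i div 4 + 1 \<in> {1..N}"
proof -
  show N: "i div 4 + 1 \<in> {1..N}" using assms(2) by auto
  have "i + 1 \<in> {4 * (i div 4 + 1) - 3..4 * (i div 4 + 1)}" by auto
  then show "gz_velocity E lam (i+1) = gz_velocity E lam (4 * (i div 4 + 1))"
    by (rule gz_velocity_block[OF assms(1) N])
qed

section \<open>Conjugation symmetry\<close>

text \<open>
  The involution of the (zero-based) indices that exchanges \<open>\<lambda>\<close> with \<open>1 / cnj \<lambda>\<close> inside each
  block of four.
\<close>

definition conj_index :: "nat \<Rightarrow> nat" where
  "conj_index i = (if i mod 4 < 2 then i + 2 else i - 2)"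

lemma conj_index_cases:
  obtains m where "i = 4*m \<and> conj_index i = 4*m+2" | m where "i = 4*m+1 \<and> conj_index i = 4*m+3"
  | m where "i = 4*m+2 \<and> conj_index i = 4*m" | m where "i = 4*m+3 \<and> conj_index i = 4*m+1"
proof -
  have i: "i = 4 * (i div 4) + i mod 4" by simp
  have "i mod 4 < 4" by simp
  then consider "i mod 4 = 0" | "i mod 4 = 1" | "i mod 4 = 2" | "i mod 4 = 3" by linarith
  then show ?thesis
  proof cases
    case 1 then show ?thesis using i by (intro that(1)[of "i div 4"]) (simp add: conj_index_def)
  next
    case 2 then show ?thesis using i by (intro that(2)[of "i div 4"]) (simp add: conj_index_def)
  next
    case 3 then show ?thesis using i by (intro that(3)[of "i div 4"]) (simp add: conj_index_def)
  next
    case 4 then show ?thesis using i by (intro that(4)[of "i div 4"]) (simp add: conj_index_def)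
  qed
qed

lemma conj_index_involution: "conj_index (conj_index i) = i"
proof -
  have "conj_index (4*m) = 4*m+2" "conj_index (4*m+1) = 4*m+3"
    "conj_index (4*m+2) = 4*m" "conj_index (4*m+3) = 4*m+1" for m
    unfolding conj_index_def by presburger+
  then show ?thesis by (cases i rule: conj_index_cases) metis+
qed

lemma conj_index_less: "conj_index i < 4*N" if "i < 4*N"
proof -
  have "conj_index i div 4 = i div 4" by (cases i rule: conj_index_cases) auto
  then show ?thesis using that by (simp flip: div_less_iff_less_mult add: mult.commute[of 4])
qed

lemma conj_index_permutes: "(\<lambda>i. if i < 4*N then conj_index i else i) permutes {0..<4*N}"
  by (rule bij_imp_permutes, rule bij_betw_byWitness[where f' = conj_index])
     (use conj_index_less conj_index_involution in auto)

lemma gz_parameters_conj_index: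
  assumes "gz_parameters E N lam gam" "i < 4*N"
  shows "lam (conj_index i + 1) = 1 / cnj (lam (i+1))"
    "gam (conj_index i + 1) = cnj (lam (i+1)) ^ 2 * cnj (gam (i+1))"
    "lam (i+1) \<noteq> 0" "cmod (lam (i+1)) \<noteq> 1"
proof -
  define k where "k = i div 4 + 1"
  have k: "k \<in> {1..N}" using assms(2) by (auto simp: k_def)
  note b = gz_parameters_block[OF assms(1) k]
  have "i + 1 = 4*k-3 \<and> conj_index i + 1 = 4*k-1 \<or> i + 1 = 4*k-2 \<and> conj_index i + 1 = 4*k
    \<or> i + 1 = 4*k-1 \<and> conj_index i + 1 = 4*k-3 \<or> i + 1 = 4*k \<and> conj_index i + 1 = 4*k-2"
    by (cases i rule: conj_index_cases) (auto simp: k_def)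
  then show "lam (conj_index i + 1) = 1 / cnj (lam (i+1))"
    "gam (conj_index i + 1) = cnj (lam (i+1)) ^ 2 * cnj (gam (i+1))"
    by (elim disjE; elim conjE; simp only: b; use b(7) in \<open>simp add: field_simps power2_eq_square\<close>)+
  show "lam (i+1) \<noteq> 0" "cmod (lam (i+1)) \<noteq> 1"
    using assms by (auto simp: gz_parameters_def)
qed

text \<open>
  Complex conjugation acts on the matrix by permuting the indices, scaling rows and columns by
  \<open>cnj \<lambda>\<close>, and transposing. The transposition accounts for the sign that the antisymmetric
  off-diagonal entries acquire.
\<close>

lemma gz_entry_conj_index:
  assumes "gz_parameters E N lam gam" "i < 4*N" "j < 4*N"
  shows "gz_entry E lam gam z t (conj_index i + 1) (conj_index j + 1) =
    cnj (lam (i+1)) * cnj (gz_entry E lam gam z t (j+1) (i+1)) * cnj (lam (j+1))"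
proof -
  note c = gz_parameters_conj_index[OF assms(1,2)] gz_parameters_conj_index[OF assms(1,3)]
  have inj: "conj_index i = conj_index j \<longleftrightarrow> i = j" by (metis conj_index_involution)
  show ?thesis
  proof (cases "i = j")
    case True
    define l where "l = lam (i+1)"
    define g where "g = gam (i+1)"
    have "l \<noteq> 0" using c(3) by (simp add: l_def)
    then have "\<i> * of_real (sqrt E) / 2 * (cnj z - z / (1 / cnj l) ^ 2)
         - 3 * \<i> * of_real (E powr (3/2)) * of_real t * ((1 / cnj l) ^ 2 - 1 / (1 / cnj l) ^ 4)
         - cnj l ^ 2 * cnj g =
       cnj l * cnj (\<i> * of_real (sqrt E) / 2 * (cnj z - z / l ^ 2)
         - 3 * \<i> * of_real (E powr (3/2)) * of_real t * (l ^ 2 - 1 / l ^ 4) - g) * cnj l"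
      by (simp add: power_divide field_simps power2_eq_square power4_eq_xxxx)
    then show ?thesis
      unfolding True gz_entry_def if_True refl c(5,6) l_def[unfolded True] g_def[unfolded True]
      by simp
  next
    case False
    then have "lam (i+1) \<noteq> lam (j+1)" using assms by (auto simp: gz_parameters_def)
    moreover have "1 / (1 / x - 1 / y) = x * (1 / (y - x)) * y" if "x \<noteq> 0" "y \<noteq> 0" "x \<noteq> y" for x y :: complex
      using that by (simp add: field_simps)
    from this[of "cnj (lam (i+1))" "cnj (lam (j+1))"]
    have "lam (i+1) \<noteq> lam (j+1) \<Longrightarrow> 1 / (1 / cnj (lam (i+1)) - 1 / cnj (lam (j+1))) =
      cnj (lam (i+1)) * cnj (1 / (lam (j+1) - lam (i+1))) * cnj (lam (j+1))"
      using c(3,7) by simp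
    ultimately show ?thesis using False inj unfolding gz_entry_def c(1,5) by simp
  qed
qed

text \<open>
  A simultaneous permutation of rows and columns and a transposition do not change the determinant, so
  the symmetry of the entries gives the claim with K the square of the product of all \<open>cnj \<lambda>\<^sub>l\<close>.
\<close>

lemma det_gz_matrix_real:
  assumes "gz_parameters E N lam gam"
  shows "\<exists>K. \<forall>z t. det (gz_matrix E N lam gam z t) = K * cnj (det (gz_matrix E N lam gam z t))"
proof (intro exI allI)
  fix z t
  let ?n = "4*N" and ?A = "gz_matrix E N lam gam z t" and ?e = "gz_entry E lam gam z t"
    and ?p = "\<lambda>i. if i < 4*N then conj_index i else i"
  have A: "?A \<in> carrier_mat ?n ?n" by (simp add: gz_matrix_def)
  have pn: "?p i < ?n" if "i < ?n" for i
    using conj_index_less[OF that] that by simp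
  have "det ?A = det (mat ?n ?n (\<lambda>(i,j). ?A $$ (?p i, ?p j)))"
    by (rule det_permute_both[OF A conj_index_permutes, symmetric])
  also have "mat ?n ?n (\<lambda>(i,j). ?A $$ (?p i, ?p j)) =
      mat ?n ?n (\<lambda>(i,j). cnj (lam (i+1)) * cnj (?e (j+1) (i+1)) * cnj (lam (j+1)))"
    by (rule eq_matI) (use pn gz_entry_conj_index[OF assms] in \<open>auto simp: gz_matrix_def\<close>)
  also have "det \<dots> = (\<Prod>i<?n. cnj (lam (i+1))) * (\<Prod>i<?n. cnj (lam (i+1))) *
      cnj (det (mat ?n ?n (\<lambda>(i,j). ?e (j+1) (i+1))))"
    unfolding det_scale det_cnj ..
  also have "mat ?n ?n (\<lambda>(i,j). ?e (j+1) (i+1)) = ?A\<^sup>T"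
    by (rule eq_matI) (auto simp: gz_matrix_def)
  also have "det (?A\<^sup>T) = det ?A" by (rule det_transpose[OF A])
  finally show "det ?A = (\<Prod>i<?n. cnj (lam (i+1))) * (\<Prod>i<?n. cnj (lam (i+1))) * cnj (det ?A)" .
qed

section \<open>A single block\<close>

lemma pick_atLeastLessThan:
  assumes "i < b - a"
  shows "pick {a..<b} i = a + i"
proof -
  have "{x \<in> {a..<b}. x < a + i} = {a..<a+i}" using assms by auto
  then show ?thesis using pick_card_in_set[of "a + i" "{a..<b}"] assms by simp
qed

lemma gz_block_eq_matrix:
  assumes "k \<in> {1..N}"
  shows "gz_block E N lam gam k z t =
    gz_matrix E 1 (\<lambda>j. lam (4*(k-1)+j)) (\<lambda>j. gam (4*(k-1)+j)) z t"
proof -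
  have "{i. i < 4*N \<and> i \<in> {4*(k-1)..<4*k}} = {4*(k-1)..<4*k}" using assms by auto
  moreover have "4*k - 4*(k-1) = 4" "\<And>i. i < 4 \<Longrightarrow> 4*(k-1) + i < 4*N" using assms by auto
  ultimately show ?thesis
    by (intro eq_matI)
       (auto simp: gz_block_def submatrix_def gz_matrix_def pick_atLeastLessThan gz_entry_def)
qed

lemma gz_parameters_shift:
  assumes "gz_parameters E N lam gam" "k \<in> {1..N}"
  shows "gz_parameters E 1 (\<lambda>j. lam (4*(k-1)+j)) (\<lambda>j. gam (4*(k-1)+j))"
proof -
  note b = gz_parameters_block[OF assms]
  have e: "4*(k-1)+1 = 4*k-3" "4*(k-1)+2 = 4*k-2" "4*(k-1)+3 = 4*k-1" "4*(k-1)+4 = 4*k"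
    using assms(2) by auto
  have r: "4*(k-1)+j \<in> {1..4*N}" if "j \<in> {1..4*1}" for j using that assms(2) by auto
  have J: "j = 1 \<or> j = 2" if "j \<in> {1..2*1}" for j :: nat using that by auto
  have "lam (4*(k-1)+2*j) = - lam (4*(k-1)+(2*j-1)) \<and>
      gam (4*(k-1)+(2*j-1)) - gam (4*(k-1)+2*j) = 1 / lam (4*(k-1)+(2*j-1))" if "j \<in> {1..2*1}" for j
    using J[OF that] e b by auto
  moreover have "lam (4*(k-1)+(4*j-1)) = 1 / cnj (lam (4*(k-1)+(4*j-3))) \<and>
      gam (4*(k-1)+(4*j-1)) = cnj (lam (4*(k-1)+(4*j-3))) ^ 2 * cnj (gam (4*(k-1)+(4*j-3)))"
    if "j \<in> {1..1}" for j
    using that e b by auto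
  moreover have "lam (4*(k-1)+l) \<noteq> lam (4*(k-1)+m)" if "l \<in> {1..4*1}" "m \<in> {1..4*1}" "l \<noteq> m" for l m
    using r[OF that(1)] r[OF that(2)] that(3) assms(1) unfolding gz_parameters_def
    by (metis add_left_cancel)
  moreover have "lam (4*(k-1)+j) \<noteq> 0" "cmod (lam (4*(k-1)+j)) \<noteq> 1" if "j \<in> {1..4*1}" for j
    using r[OF that] assms(1) unfolding gz_parameters_def by blast+
  moreover have "E > 0" using assms(1) by (simp add: gz_parameters_def)
  ultimately show ?thesis unfolding gz_parameters_def by blast
qed

text \<open>
  The left-hand side is the expanded determinant of the matrix with rows (a-p, p, u, w),
  (-p, a+p, -w, -u), (-u, w, b-q, q), (-w, u, -q, b+q), the shape of a single block: the opposite
  parameters give p and q on the diagonal as well as next to it. The difference of the two sides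
  is \<open>4 * (p * q * (u\<^sup>2 - w\<^sup>2) - u\<^sup>2 * w\<^sup>2)\<close>, which vanishes by the product of the two hypotheses.
\<close>

lemma soliton_det_identity:
  fixes a b p q u w :: complex
  assumes "p * (u + w) = u * w" "q * (u - w) = u * w"
  shows "(a-p) * ((a+p) * ((b-q) * (b+q) - q * (-q)) - (-w) * (w * (b+q) - q * u)
        + (-u) * (w * (-q) - (b-q) * u))
    - p * ((-p) * ((b-q) * (b+q) - q * (-q)) - (-w) * ((-u) * (b+q) - q * (-w))
        + (-u) * ((-u) * (-q) - (b-q) * (-w)))
    + u * ((-p) * (w * (b+q) - q * u) - (a+p) * ((-u) * (b+q) - q * (-w))
        + (-u) * ((-u) * u - w * (-w)))
    - w * ((-p) * (w * (-q) - (b-q) * u) - (a+p) * ((-u) * (-q) - (b-q) * (-w))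
        + (-w) * ((-u) * u - w * (-w)))
    = (a * b + u\<^sup>2 + w\<^sup>2)\<^sup>2"
    (is "?l = ?r")
proof -
  have "(p * (u + w)) * (q * (u - w)) = (u * w) * (u * w)" by (simp only: assms)
  then have "p * q * (u\<^sup>2 - w\<^sup>2) - u\<^sup>2 * w\<^sup>2 = 0"
    by (simp add: algebra_simps power2_eq_square)
  moreover have "?l = ?r + 4 * (p * q * (u\<^sup>2 - w\<^sup>2) - u\<^sup>2 * w\<^sup>2)"
    by (simp add: algebra_simps power2_eq_square)
  ultimately show ?thesis by simp
qed

text \<open>
  The determinant is the square of \<open>\<alpha> * \<beta> + u\<^sup>2 + w\<^sup>2\<close>. By the conjugation symmetry
  \<open>\<beta> = cnj l ^ 2 * cnj \<alpha>\<close>, and u, w are \<open>cnj l\<close> divided by \<open>|l|\<^sup>2 - 1\<close> and \<open>|l|\<^sup>2 + 1\<close>. So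
  all three summands are \<open>cnj l ^ 2\<close> times a nonnegative number, and the last one does not vanish.
\<close>

lemma det_single_block_nonzero:
  assumes "gz_parameters E 1 lam gam"
  shows "det (gz_matrix E 1 lam gam z t) \<noteq> 0"
proof -
  note b = gz_parameters_block[OF assms, of 1, simplified]
  define l where "l = lam 1"
  define e where "e = gz_entry E lam gam z t"
  define p where "p = 1 / (2 * l)"
  define q where "q = cnj l / 2"
  define u where "u = 1 / (l - 1 / cnj l)"
  define w where "w = 1 / (l + 1 / cnj l)"
  define \<alpha> where "\<alpha> = e 1 1 + p"
  define \<beta> where "\<beta> = e 3 3 + q"
  define r where "r = cmod l ^ 2"
  have lam: "lam (Suc 0) = l" "lam 2 = - l" "lam 3 = 1 / cnj l" "lam 4 = - 1 / cnj l"
    and l: "l \<noteq> 0" "cmod l \<noteq> 1"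
    using b by (simp_all add: l_def)
  have r: "l * cnj l = of_real r" "r \<noteq> 1" "r > 0"
  proof -
    show "l * cnj l = of_real r" unfolding r_def by (rule complex_norm_square[symmetric])
    show "r \<noteq> 1" using l(2) unfolding r_def by (simp add: abs_square_eq_1)
    show "r > 0" using l(1) by (simp add: r_def)
  qed
  have ne: "l - 1 / cnj l \<noteq> 0" "l + 1 / cnj l \<noteq> 0"
  proof -
    have "complex_of_real (r - 1) \<noteq> 0" "complex_of_real (r + 1) \<noteq> 0"
      using r(2,3) by (simp_all only: of_real_eq_0_iff)
    moreover have "l - 1 / cnj l = of_real (r - 1) / cnj l" "l + 1 / cnj l = of_real (r + 1) / cnj l"
      using l by (simp_all add: field_simps flip: r(1))
    ultimately show "l - 1 / cnj l \<noteq> 0" "l + 1 / cnj l \<noteq> 0"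
      using l by simp_all
  qed
  have d11: "e 1 1 = \<alpha> - p" and d33: "e 3 3 = \<beta> - q" by (simp_all add: \<alpha>_def \<beta>_def)
  have "gam 2 = gam 1 - 1 / l" "gam 4 = gam 3 - cnj l"
    using b(2,4,6) by (simp_all add: l_def)
  moreover have "1 / l = p + p" "cnj l = q + q"
    by (simp_all add: p_def q_def)
  ultimately have gam: "gam 2 = gam 1 - (p + p)" "gam 4 = gam 3 - (q + q)"
    by simp_all
  have d22: "e 2 2 = \<alpha> + p" and d44: "e 4 4 = \<beta> + q"
    by (simp_all add: \<alpha>_def \<beta>_def e_def gz_entry_def lam gam)
  have off: "e 1 2 = p" "e 1 3 = u" "e 1 4 = w" "e 2 1 = - p" "e 2 3 = - w" "e 2 4 = - u"
    "e 3 1 = - u" "e 3 2 = w" "e 3 4 = q" "e 4 1 = - w" "e 4 2 = u" "e 4 3 = - q"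
  proof -
    have m: "- l - 1 / cnj l = - (l + 1 / cnj l)" "- l + 1 / cnj l = - (l - 1 / cnj l)"
      "1 / cnj l - l = - (l - 1 / cnj l)" "- (1 / cnj l) - l = - (l + 1 / cnj l)"
      "1 / cnj l + l = l + 1 / cnj l" "- (1 / cnj l) + l = l - 1 / cnj l"
      "1 / cnj l + 1 / cnj l = 2 / cnj l" "- (1 / cnj l) - 1 / cnj l = - (2 / cnj l)"
      "- l - l = - (2 * l)" "l + l = 2 * l"
      by simp_all
    show "e 1 2 = p" "e 1 3 = u" "e 1 4 = w" "e 2 1 = - p" "e 2 3 = - w" "e 2 4 = - u"
      "e 3 1 = - u" "e 3 2 = w" "e 3 4 = q" "e 4 1 = - w" "e 4 2 = u" "e 4 3 = - q"
      unfolding e_def gz_entry_def p_def q_def u_def w_def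
      by (simp_all add: lam m divide_minus_right del: minus_diff_eq minus_add_distrib)
  qed
  have pq: "p * (u + w) = u * w" "q * (u - w) = u * w"
    using ne l unfolding p_def q_def u_def w_def by (simp_all add: divide_simps) (simp_all add: algebra_simps)
  have "det (gz_matrix E 1 lam gam z t) = (\<alpha> * \<beta> + u\<^sup>2 + w\<^sup>2)\<^sup>2"
  proof -
    have "gz_matrix E 1 lam gam z t = mat 4 4 (\<lambda>(i,j). e (i+1) (j+1))"
      by (simp add: gz_matrix_def e_def)
    moreover have "0 + 1 = (1::nat)" "1 + 1 = (2::nat)" "2 + 1 = (3::nat)" "3 + 1 = (4::nat)"
      by simp_all
    ultimately show ?thesis
      using soliton_det_identity[OF pq]
      by (simp only: det_mat_4 d11 d22 d33 d44 off)
  qed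
  moreover have "\<alpha> * \<beta> + u\<^sup>2 + w\<^sup>2 =
      cnj l ^ 2 * of_real (cmod \<alpha> ^ 2 + 1 / (r - 1)\<^sup>2 + 1 / (r + 1)\<^sup>2)"
  proof -
    have "e 3 3 = cnj l ^ 2 * cnj (e 1 1)"
      using gz_entry_conj_index[OF assms, of 0 0 z t]
      by (simp add: conj_index_def numeral_3_eq_3 e_def l_def power2_eq_square)
    then have "\<beta> = cnj l ^ 2 * cnj \<alpha>"
      using l by (simp add: \<beta>_def \<alpha>_def p_def q_def field_simps power2_eq_square)
    then have "\<alpha> * \<beta> = cnj l ^ 2 * of_real (cmod \<alpha> ^ 2)"
      by (simp only: complex_norm_square mult.left_commute)
    moreover have "u = cnj l / of_real (r - 1)" "w = cnj l / of_real (r + 1)"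
      using ne l by (simp_all add: u_def w_def field_simps flip: r(1))
    ultimately show ?thesis by (simp add: algebra_simps power_divide)
  qed
  moreover have "cmod \<alpha> ^ 2 + 1 / (r - 1)\<^sup>2 + 1 / (r + 1)\<^sup>2 > 0"
    using r(3) by (intro add_nonneg_pos add_nonneg_nonneg) auto
  ultimately show ?thesis using l
    by (metis complex_cnj_zero_iff less_irrefl mult_eq_0_iff of_real_eq_0_iff power_eq_0_iff)
qed

section \<open>Limits in a moving frame\<close>

lemma filterlim_affine_at_infinity:
  fixes p q :: complex
  assumes "q \<noteq> 0"
  shows "filterlim (\<lambda>t::real. p + q * of_real t) at_infinity at_top"
proof -
  have "filterlim (\<lambda>t::real. complex_of_real t) at_infinity at_top"
    by (rule filterlim_of_real_at_infinity)
  then have "filterlim (\<lambda>t::real. q * of_real t) at_infinity at_top"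
    using tendsto_mult_filterlim_at_infinity[OF tendsto_const assms] by blast
  then show ?thesis using tendsto_add_filterlim_at_infinity[OF tendsto_const] by blast
qed

text \<open>
  In the frame moving with velocity c the entry is affine in t. Its slope is a multiple of
  \<open>cnj \<delta> - \<delta> / \<lambda>\<^sup>2\<close>, \<open>\<delta>\<close> being the relative velocity, and the two terms have different moduli.
\<close>

lemma diagonal_entry_at_infinity:
  assumes E: "E > 0" and l: "lam l \<noteq> 0" "cmod (lam l) \<noteq> 1" and c: "c \<noteq> gz_velocity E lam l"
  shows "filterlim (\<lambda>t::real. gz_entry E lam gam (\<xi> + c * of_real t) t l l) at_infinity at_top"
proof -
  define \<delta> where "\<delta> = c - gz_velocity E lam l"
  define q where "q = \<i> * of_real (sqrt E) / 2 * (cnj \<delta> - \<delta> / lam l ^ 2)"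
  have "cnj \<delta> \<noteq> \<delta> / lam l ^ 2"
  proof
    assume "cnj \<delta> = \<delta> / lam l ^ 2"
    then have "cmod \<delta> = cmod \<delta> / cmod (lam l) ^ 2"
      by (metis complex_mod_cnj norm_divide norm_power)
    moreover have "cmod \<delta> \<noteq> 0" using c by (simp add: \<delta>_def)
    ultimately have "cmod (lam l) ^ 2 = 1" using l(1) by (simp add: eq_divide_eq)
    then show False using l by (simp add: abs_square_eq_1)
  qed
  then have "q \<noteq> 0" using E by (simp add: q_def)
  moreover have "gz_entry E lam gam (\<xi> + c * of_real t) t l l = gz_entry E lam gam \<xi> 0 l l + q * of_real t" for t
    unfolding gz_entry_travelling[where lam = lam and l = l and t = t, OF E l(1)]
    by (simp add: gz_entry_def q_def \<delta>_def algebra_simps diff_divide_distrib add_divide_distrib)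
  ultimately show ?thesis by (simp add: filterlim_affine_at_infinity)
qed

text \<open>
  Only the first summand depends on a and t. After division by it, the coefficients of the other two
  tend to 0 when it tends to infinity.
\<close>

lemma gz_entry_diag_shift:
  "gz_entry E lam gam (\<zeta> + a) t l l = gz_entry E lam gam (\<xi> + a) t l l
     + \<i> * of_real (sqrt E) / 2 * (cnj \<zeta> + - cnj \<xi>)
     + - \<i> * of_real (sqrt E) / (2 * lam l ^ 2) * (\<zeta> + - \<xi>)"
  by (simp add: gz_entry_def algebra_simps diff_divide_distrib add_divide_distrib)

lemma zpoly_gz_entry: "zpoly (\<lambda>\<zeta>. gz_entry E lam gam (\<zeta> + a) t l m)"
proof (cases "l = m")
  case True
  have "(\<lambda>\<zeta>. gz_entry E lam gam (\<zeta> + a) t m m) = (\<lambda>\<zeta>. gz_entry E lam gam (0 + a) t m m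
     + \<i> * of_real (sqrt E) / 2 * (cnj \<zeta> + - cnj 0)
     + - \<i> * of_real (sqrt E) / (2 * lam m ^ 2) * (\<zeta> + - 0))"
    by (rule ext) (rule gz_entry_diag_shift)
  then show ?thesis unfolding True by (simp only:) (intro zpoly.intros)
next
  case False
  then show ?thesis by (simp add: gz_entry_def zpoly.const)
qed

text \<open>
  A row moving with velocity c is stationary. In any other row, the diagonal entry divided by its own
  value at \<open>\<xi>\<close> tends to the constant 1, while its slope and the off-diagonal entries are constants
  divided by a quantity that tends to infinity.
\<close>

lemma gz_scaled_entry_jet_tendsto:
  fixes c \<xi> :: complex and gam :: "nat \<Rightarrow> complex"
  assumes E: "E > 0" and l: "lam l \<noteq> 0" "cmod (lam l) \<noteq> 1"
  defines "s \<equiv> \<lambda>t. if c = gz_velocity E lam l then 1 else 1 / gz_entry E lam gam (\<xi> + c * of_real t) t l l"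
  shows "jet_tendsto (\<lambda>t \<zeta>. s t * gz_entry E lam gam (\<zeta> + c * of_real t) t l m)
    (\<lambda>\<zeta>. if c = gz_velocity E lam l then gz_entry E lam gam \<zeta> 0 l m else if l = m then 1 else 0) \<xi>"
proof (cases "c = gz_velocity E lam l")
  case True
  have "gz_entry E lam gam (\<zeta> + c * of_real t) t l m = gz_entry E lam gam \<zeta> 0 l m" for \<zeta> t
    using gz_entry_travelling[where lam = lam and l = l and z = "\<zeta> + c * of_real t" and t = t, OF E l(1)]
    by (simp add: True)
  then show ?thesis
    using jet_tendsto_refl[OF zpoly_gz_entry[of E lam gam 0 0 l m], of \<xi>] by (simp add: s_def True)
next
  case False
  define d where "d = (\<lambda>t. gz_entry E lam gam (\<xi> + c * of_real t) t l l)"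
  have d: "filterlim d at_infinity at_top"
    unfolding d_def by (rule diagonal_entry_at_infinity[OF E l False])
  have s: "s = (\<lambda>t. inverse (d t))" by (simp add: s_def d_def False inverse_eq_divide)
  have s0: "(s \<longlongrightarrow> 0) at_top"
    unfolding s by (rule filterlim_compose[OF tendsto_inverse_0 d])
  have sk: "((\<lambda>t. s t * k) \<longlongrightarrow> 0) at_top" for k
    using tendsto_mult[OF s0 tendsto_const[of k]] by simp
  show ?thesis
  proof (cases "l = m")
    case True
    have "eventually (\<lambda>t. d t \<noteq> 0) at_top"
      using d by (auto dest: filterlim_at_infinity_imp_eventually_ne)
    then have "eventually (\<lambda>t. 1 = s t * d t) at_top"
      by eventually_elim (simp add: s)
    then have s1: "((\<lambda>t. s t * d t) \<longlongrightarrow> 1) at_top"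
      by (rule Lim_transform_eventually[OF tendsto_const])
    let ?a = "\<i> * of_real (sqrt E) / 2" and ?b = "- \<i> * of_real (sqrt E) / (2 * lam l ^ 2)"
    have "jet_tendsto (\<lambda>t \<zeta>. s t * d t + s t * ?a * (cnj \<zeta> + - cnj \<xi>) + s t * ?b * (\<zeta> + - \<xi>))
        (\<lambda>\<zeta>. 1 + 0 * (cnj \<zeta> + - cnj \<xi>) + 0 * (\<zeta> + - \<xi>)) \<xi>"
      by (intro jet_tendsto_add jet_tendsto_mult[OF jet_tendsto_const[OF sk]] jet_tendsto_const s1
          jet_tendsto_refl zpoly.intros)
    moreover have "s t * gz_entry E lam gam (\<zeta> + c * of_real t) t l m =
        s t * d t + s t * ?a * (cnj \<zeta> + - cnj \<xi>) + s t * ?b * (\<zeta> + - \<xi>)" for t \<zeta>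
      unfolding True[symmetric] gz_entry_diag_shift[where \<xi> = \<xi> and \<zeta> = \<zeta>] d_def
      by (simp only: distrib_left mult.assoc)
    ultimately show ?thesis using True False by simp
  next
    case lm: False
    then show ?thesis
      using jet_tendsto_const[OF sk, of "1 / (lam l - lam m)" \<xi>] False by (simp add: gz_entry_def)
  qed
qed

text \<open>
  The common part of both cases of the limit: g is the determinant of the matrix in which the rows not
  moving with velocity c are replaced by those of the identity.
\<close>

lemma gz_tendsto_of_scaled_det:
  assumes par: "gz_parameters E N lam gam"
    and g: "\<And>\<zeta>. g \<zeta> = det (mat (4*N) (4*N) (\<lambda>(i,j).
        if c = gz_velocity E lam (i+1) then gz_entry E lam gam \<zeta> 0 (i+1) (j+1) else if i = j then 1 else 0))"
    and Kg: "\<And>\<zeta>. g \<zeta> = K * cnj (g \<zeta>)" and nz: "g \<xi> \<noteq> 0"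
  shows "((\<lambda>t. gz_v E N lam gam (\<xi> + c * of_real t) t) \<longlongrightarrow> - 4 * partial_z (partial_zbar (\<lambda>z. ln (g z))) \<xi>) at_top"
    "((\<lambda>t. gz_w E N lam gam (\<xi> + c * of_real t) t) \<longlongrightarrow> 12 * partial_z (partial_z (\<lambda>z. ln (g z))) \<xi>) at_top"
proof -
  define F where "F = (\<lambda>t \<zeta>. det (gz_matrix E N lam gam (\<zeta> + c * of_real t) t))"
  define s where "s = (\<lambda>i t. if c = gz_velocity E lam (i+1) then 1
    else 1 / gz_entry E lam gam (\<xi> + c * of_real t) t (i+1) (i+1))"
  have E: "E > 0" and lam: "\<And>i. i < 4*N \<Longrightarrow> lam (i+1) \<noteq> 0 \<and> cmod (lam (i+1)) \<noteq> 1"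
    using par by (auto simp: gz_parameters_def)
  have "jet_tendsto (\<lambda>t \<zeta>. det (mat (4*N) (4*N) (\<lambda>(i,j). s i t * gz_entry E lam gam (\<zeta> + c * of_real t) t (i+1) (j+1))))
    (\<lambda>\<zeta>. det (mat (4*N) (4*N) (\<lambda>(i,j).
        if c = gz_velocity E lam (i+1) then gz_entry E lam gam \<zeta> 0 (i+1) (j+1) else if i = j then 1 else 0))) \<xi>"
  proof (rule jet_tendsto_det)
    fix i j assume i: "i < 4*N"
    have eq: "i + 1 = j + 1 \<longleftrightarrow> i = j" by simp
    from gz_scaled_entry_jet_tendsto[OF E, of lam "i+1" c gam \<xi> "j+1"] lam[OF i]
    show "jet_tendsto (\<lambda>t \<zeta>. s i t * gz_entry E lam gam (\<zeta> + c * of_real t) t (i+1) (j+1))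
     (\<lambda>\<zeta>. if c = gz_velocity E lam (i+1) then gz_entry E lam gam \<zeta> 0 (i+1) (j+1) else if i = j then 1 else 0) \<xi>"
      unfolding s_def eq by blast
  qed
  moreover have "det (mat (4*N) (4*N) (\<lambda>(i,j). s i t * gz_entry E lam gam (\<zeta> + c * of_real t) t (i+1) (j+1)))
      = (\<Prod>i<4*N. s i t) * F t \<zeta>" for t \<zeta>
    using det_scale[of "4*N" "\<lambda>i. s i t" "\<lambda>i j. gz_entry E lam gam (\<zeta> + c * of_real t) t (i+1) (j+1)" "\<lambda>_. 1"]
    by (simp add: F_def gz_matrix_def)
  ultimately have jet: "jet_tendsto (\<lambda>t \<zeta>. (\<Prod>i<4*N. s i t) * F t \<zeta>) g \<xi>"
    by (simp only: g[symmetric])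
  have F: "zpoly (F t)" for t
    unfolding F_def gz_matrix_def
    by (rule zpoly_of_jet_tendsto[OF jet_tendsto_det[OF jet_tendsto_refl[OF zpoly_gz_entry]]])
  obtain K where "\<And>z t. det (gz_matrix E N lam gam z t) = K * cnj (det (gz_matrix E N lam gam z t))"
    using det_gz_matrix_real[OF par] by blast
  then have K: "\<exists>K. \<forall>z. F t z = K * cnj (F t z)" for t unfolding F_def by blast
  note lim = log_hessian_tendsto[OF jet F K Kg nz]
  have vw: "gz_v E N lam gam (\<xi> + c * of_real t) t = - 4 * partial_z (partial_zbar (\<lambda>z. ln (F t z))) \<xi>"
    "gz_w E N lam gam (\<xi> + c * of_real t) t = 12 * partial_z (partial_z (\<lambda>z. ln (F t z))) \<xi>" for t
    using partial_shift(3,4)[where a = "- (c * of_real t)" and f = "\<lambda>z. ln (det (gz_matrix E N lam gam z t))"]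
      partial_shift(3)[where a = "- (c * of_real t)" and f = "partial_z (\<lambda>z. ln (det (gz_matrix E N lam gam z t)))"]
      partial_shift(3)[where a = "- (c * of_real t)" and f = "partial_zbar (\<lambda>z. ln (det (gz_matrix E N lam gam z t)))"]
    by (simp_all add: gz_v_def gz_w_def F_def)
  show "((\<lambda>t. gz_v E N lam gam (\<xi> + c * of_real t) t) \<longlongrightarrow> - 4 * partial_z (partial_zbar (\<lambda>z. ln (g z))) \<xi>) at_top"
    "((\<lambda>t. gz_w E N lam gam (\<xi> + c * of_real t) t) \<longlongrightarrow> 12 * partial_z (partial_z (\<lambda>z. ln (g z))) \<xi>) at_top"
    unfolding vw by (intro tendsto_mult tendsto_const lim)+
qed

lemma gz_tendsto_0:
  assumes par: "gz_parameters E N lam gam"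
    and c: "\<And>k. k \<in> {1..N} \<Longrightarrow> c \<noteq> gz_velocity E lam (4*k)"
  shows "((\<lambda>t. gz_v E N lam gam (\<xi> + c * of_real t) t) \<longlongrightarrow> 0) at_top"
    "((\<lambda>t. gz_w E N lam gam (\<xi> + c * of_real t) t) \<longlongrightarrow> 0) at_top"
proof -
  have "c \<noteq> gz_velocity E lam (i+1)" if "i < 4*N" for i
    using c gz_velocity_index[OF par that] by metis
  then have "mat (4*N) (4*N) (\<lambda>(i,j). if c = gz_velocity E lam (i+1) then gz_entry E lam gam \<zeta> 0 (i+1) (j+1)
      else if i = j then 1 else 0) = 1\<^sub>m (4*N)" for \<zeta>
    by (intro eq_matI) auto
  then have 1: "1 = det (mat (4*N) (4*N) (\<lambda>(i,j). if c = gz_velocity E lam (i+1) then gz_entry E lam gam \<zeta> 0 (i+1) (j+1)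
      else if i = j then 1 else 0))" for \<zeta>
    by simp
  show "((\<lambda>t. gz_v E N lam gam (\<xi> + c * of_real t) t) \<longlongrightarrow> 0) at_top"
    "((\<lambda>t. gz_w E N lam gam (\<xi> + c * of_real t) t) \<longlongrightarrow> 0) at_top"
    using gz_tendsto_of_scaled_det[OF par, where g = "\<lambda>_. 1" and K = 1 and \<xi> = \<xi>, OF 1] by (simp_all add: partial_const)
qed

lemma gz_tendsto_block:
  assumes par: "gz_parameters E N lam gam" and k: "k \<in> {1..N}" and c: "c = gz_velocity E lam (4*k)"
  shows "((\<lambda>t. gz_v E N lam gam (\<xi> + c * of_real t) t) \<longlongrightarrow> gz_nu E N lam gam k \<xi>) at_top"
    "((\<lambda>t. gz_w E N lam gam (\<xi> + c * of_real t) t) \<longlongrightarrow> gz_omega E N lam gam k \<xi>) at_top"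
proof -
  define a where "a = 4*(k-1)"
  have iff: "c = gz_velocity E lam (i+1) \<longleftrightarrow> i \<in> {a..<a+4}" if "i < 4*N" for i
  proof -
    have "c = gz_velocity E lam (i+1) \<longleftrightarrow> i div 4 + 1 = k"
      using gz_velocity_index[OF par that] gz_velocity_inj[OF par k] c by metis
    also have "\<dots> \<longleftrightarrow> k - 1 \<le> i div 4 \<and> i div 4 < k" using k by auto
    also have "\<dots> \<longleftrightarrow> i \<in> {a..<a+4}"
      using k by (auto simp: a_def less_eq_div_iff_mult_less_eq div_less_iff_less_mult)
    finally show ?thesis .
  qed
  obtain d where n: "4*N = a + (4 + d)"
    using k by (auto simp: a_def intro!: that[of "4*N - 4*k"])
  have g: "det (gz_block E N lam gam k \<zeta> 0) = det (mat (4*N) (4*N) (\<lambda>(i,j).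
      if c = gz_velocity E lam (i+1) then gz_entry E lam gam \<zeta> 0 (i+1) (j+1) else if i = j then 1 else 0))" for \<zeta>
  proof -
    have "det (gz_block E N lam gam k \<zeta> 0) = det (mat 4 4 (\<lambda>(i,j). gz_entry E lam gam \<zeta> 0 (a+i+1) (a+j+1)))"
      unfolding gz_block_eq_matrix[OF k] by (rule arg_cong[where f = det], rule eq_matI) (auto simp: gz_matrix_def gz_entry_def a_def)
    also have "\<dots> = det (mat (4*N) (4*N) (\<lambda>(i,j).
        if i \<in> {a..<a+4} then gz_entry E lam gam \<zeta> 0 (i+1) (j+1) else if i = j then 1 else 0))"
      unfolding n by (rule det_identity_outside_rows[symmetric])
    also have "\<dots> = det (mat (4*N) (4*N) (\<lambda>(i,j).
        if c = gz_velocity E lam (i+1) then gz_entry E lam gam \<zeta> 0 (i+1) (j+1) else if i = j then 1 else 0))"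
      by (rule arg_cong[where f = det], rule eq_matI) (use iff in simp_all)
    finally show ?thesis .
  qed
  note par1 = gz_parameters_shift[OF par k]
  obtain K where K: "det (gz_block E N lam gam k \<zeta> 0) = K * cnj (det (gz_block E N lam gam k \<zeta> 0))" for \<zeta>
    using det_gz_matrix_real[OF par1] unfolding gz_block_eq_matrix[OF k] by blast
  have nz: "det (gz_block E N lam gam k \<xi> 0) \<noteq> 0"
    unfolding gz_block_eq_matrix[OF k] by (rule det_single_block_nonzero[OF par1])
  show "((\<lambda>t. gz_v E N lam gam (\<xi> + c * of_real t) t) \<longlongrightarrow> gz_nu E N lam gam k \<xi>) at_top"
    "((\<lambda>t. gz_w E N lam gam (\<xi> + c * of_real t) t) \<longlongrightarrow> gz_omega E N lam gam k \<xi>) at_top"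
    using gz_tendsto_of_scaled_det[OF par g K nz] by (simp_all add: gz_nu_def gz_omega_def)
qed

text \<open>
  A block is the matrix of a pair with N = 1 and parameters shifted by \<open>4 * (k - 1)\<close>, so that for c
  different from its velocity its profile along the ray vanishes in the limit by \<open>gz_tendsto_0\<close>.
\<close>

lemma gz_profile_tendsto:
  assumes par: "gz_parameters E N lam gam" and k: "k \<in> {1..N}"
  shows "((\<lambda>t::real. gz_nu E N lam gam k ((\<xi> + c * of_real t) - gz_velocity E lam (4*k) * of_real t))
          \<longlongrightarrow> (if c \<noteq> gz_velocity E lam (4*k) then 0 else gz_nu E N lam gam k \<xi>)) at_top"
    "((\<lambda>t::real. gz_omega E N lam gam k ((\<xi> + c * of_real t) - gz_velocity E lam (4*k) * of_real t))
          \<longlongrightarrow> (if c \<noteq> gz_velocity E lam (4*k) then 0 else gz_omega E N lam gam k \<xi>)) at_top"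
proof -
  let ?lam = "\<lambda>j. lam (4*(k-1)+j)" and ?gam = "\<lambda>j. gam (4*(k-1)+j)"
  have "gz_nu E N lam gam k (z - gz_velocity E lam (4*k) * of_real t) = gz_v E 1 ?lam ?gam z t"
    "gz_omega E N lam gam k (z - gz_velocity E lam (4*k) * of_real t) = gz_w E 1 ?lam ?gam z t" for z t
    unfolding gz_nu_travelling[OF par k, symmetric] gz_omega_travelling[OF par k, symmetric]
    by (simp_all only: gz_block_eq_matrix[OF k] gz_v_def gz_w_def)
  moreover have "gz_velocity E ?lam (4*j) = gz_velocity E lam (4*k)" if "j \<in> {1..1}" for j
  proof -
    have "4*(k-1) + 4*j = 4*k" using that k by auto
    then show ?thesis by (simp only: gz_velocity_def)
  qed
  ultimately show "((\<lambda>t::real. gz_nu E N lam gam k ((\<xi> + c * of_real t) - gz_velocity E lam (4*k) * of_real t))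
          \<longlongrightarrow> (if c \<noteq> gz_velocity E lam (4*k) then 0 else gz_nu E N lam gam k \<xi>)) at_top"
    "((\<lambda>t::real. gz_omega E N lam gam k ((\<xi> + c * of_real t) - gz_velocity E lam (4*k) * of_real t))
          \<longlongrightarrow> (if c \<noteq> gz_velocity E lam (4*k) then 0 else gz_omega E N lam gam k \<xi>)) at_top"
    using gz_tendsto_0[OF gz_parameters_shift[OF par k], of c \<xi>]
    by (cases "c = gz_velocity E lam (4*k)"; simp)+
qed

theorem theorem2p1:
  fixes E :: real and N :: nat and lam gam :: "nat \<Rightarrow> complex"
    and v w :: "complex \<Rightarrow> real \<Rightarrow> complex"
  assumes "gz_parameters E N lam gam"
    and "v = gz_v E N lam gam"
    and "w = gz_w E N lam gam"
  shows "\<forall>c \<xi> :: complex.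
    (\<exists>L. ((\<lambda>t::real. v (\<xi> + c * of_real t) t) \<longlongrightarrow> L) at_top \<and>
         ((\<lambda>t::real. \<Sum>k=1..N. gz_nu E N lam gam k
              ((\<xi> + c * of_real t) - gz_velocity E lam (4*k) * of_real t)) \<longlongrightarrow> L) at_top) \<and>
    (\<exists>L. ((\<lambda>t::real. w (\<xi> + c * of_real t) t) \<longlongrightarrow> L) at_top \<and>
         ((\<lambda>t::real. \<Sum>k=1..N. gz_omega E N lam gam k
              ((\<xi> + c * of_real t) - gz_velocity E lam (4*k) * of_real t)) \<longlongrightarrow> L) at_top) \<and>
    (\<forall>k\<in>{1..N}.
       ((\<lambda>t::real. gz_nu E N lam gam k
            ((\<xi> + c * of_real t) - gz_velocity E lam (4*k) * of_real t))
          \<longlongrightarrow> (if c \<noteq> gz_velocity E lam (4*k) then 0 else gz_nu E N lam gam k \<xi>)) at_top \<and>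
       ((\<lambda>t::real. gz_omega E N lam gam k
            ((\<xi> + c * of_real t) - gz_velocity E lam (4*k) * of_real t))
          \<longlongrightarrow> (if c \<noteq> gz_velocity E lam (4*k) then 0 else gz_omega E N lam gam k \<xi>)) at_top)"
proof (intro allI)
  fix c \<xi> :: complex
  note par = assms(1)
  let ?sel = "\<lambda>p. \<Sum>k=1..N. if c \<noteq> gz_velocity E lam (4*k) then 0 else (p k :: complex)"
  have lim: "((\<lambda>t. v (\<xi> + c * of_real t) t) \<longlongrightarrow> ?sel (\<lambda>k. gz_nu E N lam gam k \<xi>)) at_top \<and>
    ((\<lambda>t. w (\<xi> + c * of_real t) t) \<longlongrightarrow> ?sel (\<lambda>k. gz_omega E N lam gam k \<xi>)) at_top"
  proof (cases "\<exists>k\<in>{1..N}. c = gz_velocity E lam (4*k)")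
    case True
    then obtain k where k: "k \<in> {1..N}" "c = gz_velocity E lam (4*k)" by blast
    have "?sel p = (\<Sum>j=1..N. if j = k then p k else 0)" for p
      using gz_velocity_inj[OF par k(1)] k(2) by (intro sum.cong) auto
    then have "?sel p = p k" for p using k(1) by simp
    then show ?thesis using gz_tendsto_block[OF par k] assms(2,3) by simp
  next
    case False
    then have "?sel p = 0" for p by (intro sum.neutral) auto
    then show ?thesis using gz_tendsto_0[OF par, of c \<xi>] False assms(2,3) by auto
  qed
  note prof = gz_profile_tendsto[OF par, of _ \<xi> c]
  show "(\<exists>L. ((\<lambda>t::real. v (\<xi> + c * of_real t) t) \<longlongrightarrow> L) at_top \<and>
         ((\<lambda>t::real. \<Sum>k=1..N. gz_nu E N lam gam k
              ((\<xi> + c * of_real t) - gz_velocity E lam (4*k) * of_real t)) \<longlongrightarrow> L) at_top) \<and>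
    (\<exists>L. ((\<lambda>t::real. w (\<xi> + c * of_real t) t) \<longlongrightarrow> L) at_top \<and>
         ((\<lambda>t::real. \<Sum>k=1..N. gz_omega E N lam gam k
              ((\<xi> + c * of_real t) - gz_velocity E lam (4*k) * of_real t)) \<longlongrightarrow> L) at_top) \<and>
    (\<forall>k\<in>{1..N}.
       ((\<lambda>t::real. gz_nu E N lam gam k
            ((\<xi> + c * of_real t) - gz_velocity E lam (4*k) * of_real t))
          \<longlongrightarrow> (if c \<noteq> gz_velocity E lam (4*k) then 0 else gz_nu E N lam gam k \<xi>)) at_top \<and>
       ((\<lambda>t::real. gz_omega E N lam gam k
            ((\<xi> + c * of_real t) - gz_velocity E lam (4*k) * of_real t))
          \<longlongrightarrow> (if c \<noteq> gz_velocity E lam (4*k) then 0 else gz_omega E N lam gam k \<xi>)) at_top)"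
    using lim by (intro conjI exI ballI) (assumption | erule conjunct1 | erule conjunct2 | rule tendsto_sum prof | assumption)+
qed

end
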